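(* Let $0<\nu<\frac12$ and $\lambda>0$. The law $\mathfrak{h}_\nu(x,t)$ of the process $\mathcal{H}^\nu(t)=H_1^{2\nu}(t)+(2\lambda)^{1/\nu}H_2^{\nu}(t)$, $t>0$, solves the fractional problem $$ \begin{cases} \dfrac{\partial}{\partial t}\mathfrak{h}_\nu(x,t)=-\left(\dfrac{\partial^{2\nu}}{\partial x^{2\nu}}+2\lambda\dfrac{\partial^{\nu}}{\partial x^{\nu}}\right)\mathfrak{h}_\nu(x,t), & x>0,\ t>0,\\[2mm] \mathfrak{h}_\nu(0,t)=0,\\ \mathfrak{h}_\nu(x,0)=\delta(x), \end{cases} $$ where the fractional derivatives are in the Riemann-Liouville sense.
   Context: For $0<\alpha<1$, $H^\alpha(t)$, $t>0$, denotes the totally positively skewed stable process (stable subordinator) with Laplace transform $\mathbb{E}e^{-\mu H^\alpha(t)}=e^{-t\mu^\alpha}$, $\mu>0$. The processes $H_1^{2\nu}$ and $H_2^\nu$ are independent stable subordinators of orders $2\nu$ and $\nu$ respectively. "Law" means probability density: $\Pr\{\mathcal{H}^\nu(t)\in dx\}=\mathfrak{h}_\nu(x,t)\,dx$, $x\ge 0$. $\delta$ is the Dirac delta. The Riemann-Liouville fractional derivative of order $\alpha$, $m-1<\alpha<m$, $m\in\mathbb{N}$, is $$\frac{\partial^\alpha}{\partial x^\alpha}f(x)=\frac{1}{\Gamma(m-\alpha)}\frac{d^m}{dx^m}\int_0^x\frac{f(s)}{(x-s)^{\alpha+1-m}}\,ds .$$ *)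

theory Defs
  imports "HOL-Probability.Probability"
begin

text \<open>Processes are families \<open>H t\<close> of real random variables; only the times \<open>t \<ge> 0\<close> matter.\<close>

definition independent_increments :: "'a measure \<Rightarrow> (real \<Rightarrow> 'a \<Rightarrow> real) \<Rightarrow> bool" where
  "independent_increments M H \<longleftrightarrow>
     (\<forall>(n::nat) (t::nat \<Rightarrow> real). 0 \<le> t 0 \<longrightarrow> mono t \<longrightarrow>
        prob_space.indep_vars M (\<lambda>_. borel) (\<lambda>i \<omega>. H (t (Suc i)) \<omega> - H (t i) \<omega>) {..<n})"

definition stationary_increments :: "'a measure \<Rightarrow> (real \<Rightarrow> 'a \<Rightarrow> real) \<Rightarrow> bool" where
  "stationary_increments M H \<longleftrightarrow>
     (\<forall>s\<ge>0. \<forall>t\<ge>0. distr M borel (\<lambda>\<omega>. H (s + t) \<omega> - H s \<omega>) = distr M borel (H t))"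

definition subordinator :: "'a measure \<Rightarrow> (real \<Rightarrow> 'a \<Rightarrow> real) \<Rightarrow> bool" where
  "subordinator M H \<longleftrightarrow>
     (\<forall>t\<ge>0. H t \<in> borel_measurable M) \<and>
     (AE \<omega> in M. H 0 \<omega> = 0) \<and>
     independent_increments M H \<and>
     stationary_increments M H \<and>
     (AE \<omega> in M. mono_on {0..} (\<lambda>t. H t \<omega>)) \<and>
     (AE \<omega> in M. \<forall>t\<ge>0. continuous (at_right t) (\<lambda>t. H t \<omega>))"

definition stable_subordinator :: "'a measure \<Rightarrow> real \<Rightarrow> (real \<Rightarrow> 'a \<Rightarrow> real) \<Rightarrow> bool" where
  "stable_subordinator M \<alpha> H \<longleftrightarrow>
     0 < \<alpha> \<and> \<alpha> < 1 \<and> subordinator M H \<and>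
     (\<forall>t>0. \<forall>\<mu>>0. (LINT \<omega>|M. exp (- \<mu> * H t \<omega>)) = exp (- t * \<mu> powr \<alpha>))"

text \<open>Independence of the whole paths, as random elements of the product space over the times
  \<open>t \<ge> 0\<close>; this is stronger than independence of \<open>H1 t\<close> and \<open>H2 t\<close> at each fixed time.\<close>

definition independent_processes ::
    "'a measure \<Rightarrow> (real \<Rightarrow> 'a \<Rightarrow> real) \<Rightarrow> (real \<Rightarrow> 'a \<Rightarrow> real) \<Rightarrow> bool" where
  "independent_processes M H1 H2 \<longleftrightarrow>
     prob_space.indep_var M
       (\<Pi>\<^sub>M t\<in>{0..}. borel) (\<lambda>\<omega>. \<lambda>t\<in>{0..}. H1 t \<omega>)
       (\<Pi>\<^sub>M t\<in>{0..}. borel) (\<lambda>\<omega>. \<lambda>t\<in>{0..}. H2 t \<omega>)"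

text \<open>\<open>h x t\<close> is the law of \<open>X t\<close>, \<open>t > 0\<close>, a process with values in the half-line:
  \<open>P (X t \<in> dx) = h x t dx\<close> for \<open>x \<ge> 0\<close>.  A density is determined only almost everywhere;
  continuity on the closed half-line singles out the version for which the value at \<open>x = 0\<close> and
  pointwise derivatives are meaningful.\<close>

definition is_law :: "'a measure \<Rightarrow> (real \<Rightarrow> 'a \<Rightarrow> real) \<Rightarrow> (real \<Rightarrow> real \<Rightarrow> real) \<Rightarrow> bool" where
  "is_law M X h \<longleftrightarrow>
     (\<forall>t>0. (\<forall>x\<ge>0. 0 \<le> h x t) \<and>
            continuous_on {0..} (\<lambda>x. h x t) \<and>
            distributed M lborel (X t) (\<lambda>x. ennreal (indicator {0..} x * h x t)))"

text \<open>Riemann-Liouville derivative of non-integer order \<open>\<alpha> > 0\<close>.  With \<open>m - 1 < \<alpha> < m\<close> we have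
  \<open>m = nat \<lceil>\<alpha>\<rceil>\<close>.  Since integrals and \<open>deriv\<close> are total, existence is recorded separately
  in \<open>rl_differentiable\<close>.\<close>

definition rl_kernel_integral :: "real \<Rightarrow> (real \<Rightarrow> real) \<Rightarrow> real \<Rightarrow> real" where
  "rl_kernel_integral \<alpha> f x =
     (LINT s:{0<..<x}|lborel. f s / (x - s) powr (\<alpha> + 1 - real (nat \<lceil>\<alpha>\<rceil>)))"

definition rl_deriv :: "real \<Rightarrow> (real \<Rightarrow> real) \<Rightarrow> real \<Rightarrow> real" where
  "rl_deriv \<alpha> f x =
     1 / Gamma (real (nat \<lceil>\<alpha>\<rceil>) - \<alpha>) * (deriv ^^ nat \<lceil>\<alpha>\<rceil>) (rl_kernel_integral \<alpha> f) x"

text \<open>Existence of the Riemann-Liouville derivative at every point of the open half-line.\<close>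

definition rl_differentiable :: "real \<Rightarrow> (real \<Rightarrow> real) \<Rightarrow> bool" where
  "rl_differentiable \<alpha> f \<longleftrightarrow>
     (\<forall>x>0. set_integrable lborel {0<..<x} (\<lambda>s. f s / (x - s) powr (\<alpha> + 1 - real (nat \<lceil>\<alpha>\<rceil>))) \<and>
            (\<forall>k<nat \<lceil>\<alpha>\<rceil>. (deriv ^^ k) (rl_kernel_integral \<alpha> f) differentiable (at x)))"

text \<open>The initial condition \<open>h(x,0) = \<delta>(x)\<close>: the measures \<open>h(x,t) dx\<close> on the half-line converge
  weakly to the Dirac measure at \<open>0\<close> as \<open>t\<close> decreases to \<open>0\<close>.\<close>

definition initial_dirac :: "(real \<Rightarrow> real \<Rightarrow> real) \<Rightarrow> bool" where
  "initial_dirac h \<longleftrightarrow>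
     (\<forall>f :: real \<Rightarrow> real. continuous_on UNIV f \<longrightarrow> bounded (range f) \<longrightarrow>
        ((\<lambda>t. LINT x:{0..}|lborel. f x * h x t) \<longlongrightarrow> f 0) (at_right 0))"

end

theory Submission
  imports Defs "HOL-Complex_Analysis.Complex_Analysis"
begin

text \<open>
  Put \<open>\<psi>(s) = s\<^sup>2\<^sup>\<nu> + 2\<lambda> s\<^sup>\<nu>\<close>.  By independence the Laplace transform of the law at time \<open>t\<close> is
  \<open>exp (- t \<psi>(s))\<close> for real \<open>s > 0\<close>, hence by analytic continuation for \<open>Re s > 0\<close>.  Since
  \<open>2\<nu> < 1\<close>, \<open>Re \<psi>(s) \<ge> cos (\<pi>\<nu>) |s|\<^sup>2\<^sup>\<nu>\<close> there, so the Bromwich integrals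
  \<open>J\<^sub>a(x,t) = (2\<pi>i)\<^sup>-\<^sup>1 \<integral> s\<^sup>a exp (s x - t \<psi>(s)) ds\<close> over \<open>Re s = 1\<close> converge absolutely, and \<open>J\<^sub>0\<close> is the
  density.  Differentiation under the integral gives \<open>\<partial>\<^sub>x J\<^sub>a = J\<^sub>a\<^sub>+\<^sub>1\<close> and
  \<open>\<partial>\<^sub>t J\<^sub>0 = - (J\<^sub>2\<^sub>\<nu> + 2\<lambda> J\<^sub>\<nu>)\<close>.  As \<open>J\<^sub>0\<close> vanishes on the negative half-line, Fubini and
  \<open>\<integral> u\<^sup>-\<^sup>\<alpha> exp (- s u) du = \<Gamma>(1-\<alpha>) s\<^sup>\<alpha>\<^sup>-\<^sup>1\<close> identify the fractional integral of order \<open>1 - \<alpha>\<close> of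
  \<open>J\<^sub>0\<close> with \<open>J\<close> of index \<open>\<alpha> - 1\<close>, whose \<open>x\<close>-derivative \<open>J\<^sub>\<alpha>\<close> is therefore the Riemann-Liouville
  derivative of \<open>J\<^sub>0\<close>.  The initial condition is right-continuity of the paths at \<open>0\<close>.
\<close>

section \<open>Laplace transforms in the right half-plane\<close>

text \<open>By the mean value inequality on the convex ball, \<open>g\<close> dominates the
  difference quotients, so dominated convergence applies along every sequence tending to
  \<open>z0\<close>. The field is left open because the Laplace transforms need a complex parameter
  and the Bromwich integrals a real one.\<close>

lemma has_field_derivative_lebesgue_integral:
  fixes f f' :: "'k::{real_normed_field, banach, second_countable_topology} \<Rightarrow> 'a \<Rightarrow> 'k"
  assumes r: "r > 0"
    and f: "\<And>z. z \<in> ball z0 r \<Longrightarrow> integrable M (f z)"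
    and f': "f' z0 \<in> borel_measurable M"
    and g: "integrable M g"
    and D: "AE w in M. \<forall>z\<in>ball z0 r.
              ((\<lambda>z. f z w) has_field_derivative f' z w) (at z) \<and> norm (f' z w) \<le> g w"
  shows "((\<lambda>z. \<integral>w. f z w \<partial>M) has_field_derivative (\<integral>w. f' z0 w \<partial>M)) (at z0)"
proof -
  have z0: "z0 \<in> ball z0 r" using r by simp
  have "((\<lambda>z. ((\<integral>w. f z w \<partial>M) - (\<integral>w. f z0 w \<partial>M)) / (z - z0)) \<longlongrightarrow> (\<integral>w. f' z0 w \<partial>M))
          (at z0 within ball z0 r)"
    unfolding tendsto_at_iff_sequentially
  proof (intro allI impI)
    fix X :: "nat \<Rightarrow> 'k"
    assume X: "\<forall>i. X i \<in> ball z0 r - {z0}" and lim: "X \<longlonglongrightarrow> z0"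
    have "(\<lambda>i. \<integral>w. (f (X i) w - f z0 w) / (X i - z0) \<partial>M) \<longlonglongrightarrow> (\<integral>w. f' z0 w \<partial>M)"
    proof (rule integral_dominated_convergence[OF f' _ g])
      show "(\<lambda>w. (f (X i) w - f z0 w) / (X i - z0)) \<in> borel_measurable M" for i
        using f[of "X i"] f[OF z0] X by auto
      show "AE w in M. (\<lambda>i. (f (X i) w - f z0 w) / (X i - z0)) \<longlonglongrightarrow> f' z0 w"
        using D
      proof eventually_elim
        case (elim w)
        have "((\<lambda>z. f z w) has_field_derivative f' z0 w) (at z0)"
          using elim z0 by blast
        then have "((\<lambda>z. (f z w - f z0 w) / (z - z0)) \<longlongrightarrow> f' z0 w) (at z0 within ball z0 r)"
          by (simp only: has_field_derivative_iff at_within_open[OF z0 open_ball])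
        from this[unfolded tendsto_at_iff_sequentially comp_def, rule_format, of X] X lim
        show ?case by simp
      qed
      show "AE w in M. norm ((f (X i) w - f z0 w) / (X i - z0)) \<le> g w" for i
        using D
      proof eventually_elim
        case (elim w)
        have "norm (f (X i) w - f z0 w) \<le> g w * norm (X i - z0)"
        proof (rule field_differentiable_bound[OF convex_ball[of z0 r]])
          show "((\<lambda>z. f z w) has_field_derivative f' z w) (at z within ball z0 r)"
            if "z \<in> ball z0 r" for z using that elim has_field_derivative_at_within by blast
          show "norm (f' z w) \<le> g w" if "z \<in> ball z0 r" for z using that elim by blast
          show "X i \<in> ball z0 r" using X by blast
        qed (use r in simp)
        then show ?case using X by (simp add: norm_divide divide_le_eq)
      qed
    qed
    moreover have "(\<integral>w. (f (X i) w - f z0 w) / (X i - z0) \<partial>M) =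
        ((\<integral>w. f (X i) w \<partial>M) - (\<integral>w. f z0 w \<partial>M)) / (X i - z0)" for i
      using f[of "X i"] f[OF z0] X by simp
    ultimately show "((\<lambda>z. ((\<integral>w. f z w \<partial>M) - (\<integral>w. f z0 w \<partial>M)) / (z - z0)) \<circ> X)
        \<longlonglongrightarrow> (\<integral>w. f' z0 w \<partial>M)"
      unfolding comp_def by (simp only:)
  qed
  then show ?thesis by (simp only: has_field_derivative_iff at_within_open[OF z0 open_ball])
qed

text \<open>Both sides are holomorphic in the half-plane and agree on the positive real axis, which
  accumulates at 1; the identity theorem does the rest. Only integrability of the exponentials is
  assumed of \<open>N\<close>, since one application is to the infinite measure with density
  \<open>u powr (b - 1)\<close> on the half-line.\<close>

lemma laplace_analytic_continuation:
  fixes N :: "real measure" and G :: "complex \<Rightarrow> complex"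
  assumes N [measurable_cong]: "sets N = sets borel"
    and nonneg: "AE x in N. 0 \<le> x"
    and int: "\<And>\<mu>. 0 < \<mu> \<Longrightarrow> integrable N (\<lambda>x. exp (- \<mu> * x))"
    and eq: "\<And>\<mu>. 0 < \<mu> \<Longrightarrow> complex_of_real (\<integral>x. exp (- \<mu> * x) \<partial>N) = G (of_real \<mu>)"
    and G: "G holomorphic_on {s. 0 < Re s}"
    and s: "0 < Re s"
  shows "(\<integral>x. exp (- s * of_real x) \<partial>N) = G s"
proof -
  let ?S = "{s::complex. 0 < Re s}"
  define L where "L s = (\<integral>x. exp (- s * of_real x) \<partial>N)" for s :: complex
  have cint: "integrable N (\<lambda>x. exp (- s * complex_of_real x))" if "0 < Re s" for s
    by (rule Bochner_Integration.integrable_bound[OF int[OF that]]) (auto simp: norm_exp_eq_Re)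
  have opn: "open ?S" by (rule open_halfspace_Re_gt)
  have "(L has_field_derivative (\<integral>x. - of_real x * exp (- s * of_real x) \<partial>N)) (at s)"
    if s: "0 < Re s" for s
    unfolding L_def
  proof (rule has_field_derivative_lebesgue_integral)
    show "0 < Re s / 2" using s by simp
    have re: "Re s / 2 < Re z" if "z \<in> ball s (Re s / 2)" for z
      using that abs_Re_le_cmod[of "s - z"] by (simp add: dist_norm)
    show "integrable N (\<lambda>x. exp (- z * complex_of_real x))" if "z \<in> ball s (Re s / 2)" for z
      using cint[of z] re[OF that] s by simp
    \<comment> \<open>On the ball the decay rate is at least \<open>Re s / 2\<close>. Half of it
      absorbs the factor \<open>x\<close> produced by differentiation, and the rate
      \<open>Re s / 4\<close> remains.\<close>
    show "integrable N (\<lambda>x. 4 / Re s * exp (- (Re s / 4) * x))"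
      using int[of "Re s / 4"] s by simp
    show "AE x in N. \<forall>z\<in>ball s (Re s / 2).
        ((\<lambda>z. exp (- z * complex_of_real x)) has_field_derivative
            - of_real x * exp (- z * of_real x)) (at z) \<and>
        norm (- of_real x * exp (- z * of_real x)) \<le> 4 / Re s * exp (- (Re s / 4) * x)"
      using nonneg
    proof eventually_elim
      case (elim x)
      have "((\<lambda>z. exp (- z * complex_of_real x)) has_field_derivative
            - of_real x * exp (- z * of_real x)) (at z)" for z
        by (auto intro!: derivative_eq_intros)
      moreover have "norm (- of_real x * exp (- z * of_real x)) \<le> 4 / Re s * exp (- (Re s / 4) * x)"
        if "z \<in> ball s (Re s / 2)" for z
      proof -
        have "norm (- of_real x * exp (- z * of_real x)) = x * exp (- Re z * x)"
          using elim by (simp add: norm_mult norm_exp_eq_Re)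
        also have "\<dots> \<le> x * exp (- (Re s / 2) * x)"
          using elim mult_right_mono[OF less_imp_le[OF re[OF that]], of x] by (intro mult_left_mono) auto
        also have "\<dots> \<le> (4 / Re s * exp (Re s / 4 * x)) * exp (- (Re s / 2) * x)"
        proof (rule mult_right_mono)
          have "Re s / 4 * x \<le> exp (Re s / 4 * x)"
            using exp_ge_add_one_self[of "Re s / 4 * x"] by linarith
          then show "x \<le> 4 / Re s * exp (Re s / 4 * x)" using s by (simp add: field_simps)
        qed simp
        also have "\<dots> = 4 / Re s * exp (- (Re s / 4) * x)"
          by (simp add: mult.assoc flip: exp_add)
        finally show ?thesis .
      qed
      ultimately show ?case by blast
    qed
  qed measurable
  then have L: "L holomorphic_on ?S"
    using opn by (auto simp: holomorphic_on_open)
  have "L s - G s = 0"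
  proof (rule analytic_continuation[where f = "\<lambda>s. L s - G s" and w = s and S = ?S and U = "of_real ` {0<..}" and \<xi> = 1])
    show "(\<lambda>s. L s - G s) holomorphic_on ?S" using L G by (intro holomorphic_intros)
    show "connected ?S" by (intro convex_connected convex_halfspace_Re_gt)
    show "(1::complex) islimpt of_real ` {0<..}"
      unfolding islimpt_approachable
    proof (intro allI impI)
      fix e :: real assume "e > 0"
      then show "\<exists>x'\<in>complex_of_real ` {0<..}. x' \<noteq> 1 \<and> dist x' 1 < e"
        by (intro bexI[OF _ imageI[of "1 + e / 2"]]) (auto simp: dist_norm norm_divide)
    qed
    show "L z - G z = 0" if z: "z \<in> of_real ` {0<..}" for z
    proof -
      obtain \<mu> where \<mu>: "z = of_real \<mu>" "0 < \<mu>" using z by blast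
      have "L z = complex_of_real (\<integral>x. exp (- \<mu> * x) \<partial>N)"
        unfolding L_def \<mu>(1) integral_complex_of_real[symmetric]
        by (intro Bochner_Integration.integral_cong refl)
          (metis exp_of_real of_real_minus of_real_mult)
      then show ?thesis using eq \<mu> by simp
    qed
  qed (use opn s in auto)
  then show ?thesis by (simp add: L_def)
qed

text \<open>Euler's integral for Gamma, rescaled by \<open>u\<close> to
  \<open>\<mu> * u\<close>.\<close>

lemma has_bochner_integral_Gamma:
  fixes b \<mu> :: real
  assumes b: "0 < b" and \<mu>: "0 < \<mu>"
  shows "has_bochner_integral lborel (\<lambda>u. indicator {0<..} u * u powr (b - 1) * exp (- \<mu> * u))
    (Gamma b * \<mu> powr (- b))"
proof -
  let ?f = "\<lambda>u::real. indicator {0<..} u * u powr (b - 1) * exp (- u)"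
  have "has_bochner_integral lborel ?f (Gamma b)"
  proof (rule has_bochner_integral_nn_integral)
    have "ennreal (Gamma b) = (\<integral>\<^sup>+u. ennreal (indicator {0..} u * u powr (b - 1) / exp u) \<partial>lborel)"
      by (rule Gamma_conv_nn_integral_real[OF b])
    also have "\<dots> = (\<integral>\<^sup>+u. ennreal (?f u) \<partial>lborel)"
      by (rule nn_integral_cong) (auto simp: indicator_def exp_minus field_simps)
    finally show "(\<integral>\<^sup>+u. ennreal (?f u) \<partial>lborel) = ennreal (Gamma b)" ..
    show "0 \<le> Gamma b" using b by (simp add: Gamma_real_pos less_imp_le)
  qed auto
  from lborel_has_bochner_integral_real_affine_iff[THEN iffD1, OF _ this, of \<mu> 0] \<mu>
  have *: "has_bochner_integral lborel (\<lambda>u. ?f (\<mu> * u)) (Gamma b / \<mu>)"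
    by (simp add: divide_inverse_commute)
  have "has_bochner_integral lborel (\<lambda>u. \<mu> powr (1 - b) * ?f (\<mu> * u)) (\<mu> powr (1 - b) * (Gamma b / \<mu>))"
    by (rule has_bochner_integral_mult_right) (use * in simp)
  also have "(\<lambda>u. \<mu> powr (1 - b) * ?f (\<mu> * u)) =
      (\<lambda>u. indicator {0<..} u * u powr (b - 1) * exp (- \<mu> * u))"
  proof
    fix u :: real
    have "\<mu> powr (1 - b) * \<mu> powr (b - 1) = 1" using \<mu> by (simp flip: powr_add)
    then have "\<mu> powr (1 - b) * (\<mu> * u) powr (b - 1) = u powr (b - 1)" if "0 < u"
      using \<mu> that by (simp add: powr_mult flip: mult.assoc)
    then show "\<mu> powr (1 - b) * ?f (\<mu> * u) = indicator {0<..} u * u powr (b - 1) * exp (- \<mu> * u)"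
      using \<mu> by (auto simp: indicator_def zero_less_mult_iff)
  qed
  also have "\<mu> powr (1 - b) * (Gamma b / \<mu>) = Gamma b * \<mu> powr (- b)"
    using \<mu> by (simp add: powr_diff powr_minus field_simps)
  finally show ?thesis .
qed

text \<open>Euler's integral continued analytically in \<open>s\<close>; the principal branch of the
  power is holomorphic for \<open>Re s > 0\<close>. With \<open>b = 1 - \<alpha>\<close> this is the
  Laplace transform of the Riemann-Liouville kernel.\<close>

lemma complex_Gamma_integral:
  fixes b :: real and s :: complex
  assumes b: "0 < b" and s: "0 < Re s"
  shows "integrable lborel (\<lambda>u. of_real (indicator {0<..} u * u powr (b - 1)) * exp (- s * of_real u))"
    and "(\<integral>u. of_real (indicator {0<..} u * u powr (b - 1)) * exp (- s * of_real u) \<partial>lborel)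
      = of_real (Gamma b) * s powr (- of_real b)"
proof -
  define w where "w u = indicator {0<..} u * u powr (b - 1)" for u :: real
  have w [measurable]: "w \<in> borel_measurable borel" unfolding w_def by measurable
  have w0: "0 \<le> w u" for u by (simp add: w_def)
  note G = has_bochner_integral_Gamma[OF b, folded w_def]
  have "integrable lborel (\<lambda>u. w u * exp (- Re s * u))"
    using G[OF s] by (auto simp: has_bochner_integral_iff)
  then show "integrable lborel (\<lambda>u. of_real (indicator {0<..} u * u powr (b - 1)) * exp (- s * of_real u))"
    unfolding w_def[symmetric]
    by (rule Bochner_Integration.integrable_bound) (auto simp: norm_mult w0)
  have "(\<integral>u. exp (- s * of_real u) \<partial>density lborel (\<lambda>u. ennreal (w u))) =
      of_real (Gamma b) * s powr (- of_real b)"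
  proof (rule laplace_analytic_continuation)
    show "AE u in density lborel (\<lambda>u. ennreal (w u)). 0 \<le> u"
      by (auto simp: AE_density w_def indicator_def split: if_splits)
    show "integrable (density lborel (\<lambda>u. ennreal (w u))) (\<lambda>u. exp (- \<mu> * u))" if "0 < \<mu>" for \<mu>
      using G[OF that] by (subst integrable_density) (auto simp: w0 has_bochner_integral_iff)
    show "complex_of_real (\<integral>u. exp (- \<mu> * u) \<partial>density lborel (\<lambda>u. ennreal (w u))) =
        of_real (Gamma b) * of_real \<mu> powr (- of_real b)" if "0 < \<mu>" for \<mu>
      using G[OF that] that powr_of_real[of \<mu> "- b"]
      by (subst integral_density) (auto simp: w0 has_bochner_integral_iff)
    show "(\<lambda>s. of_real (Gamma b) * s powr (- of_real b)) holomorphic_on {s. 0 < Re s}"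
      by (intro holomorphic_intros) (auto simp: complex_nonpos_Reals_iff)
  qed (use s in auto)
  then show "(\<integral>u. of_real (indicator {0<..} u * u powr (b - 1)) * exp (- s * of_real u) \<partial>lborel)
      = of_real (Gamma b) * s powr (- of_real b)"
    by (subst (asm) integral_density) (auto simp: w0 scaleR_conv_of_real w_def)
qed

section \<open>Fourier inversion for integrable characteristic functions\<close>

text \<open>Levy's inversion theorem gives the measure as a limit of integrals over growing
  symmetric intervals. Since \<open>char M\<close> is integrable, the limit is an absolutely
  convergent integral. Its kernel \<open>K \<theta>\<close> is the integral of
  \<open>iexp (- (\<theta> * x))\<close> over \<open>{a..b}\<close>, and Fubini exchanges the two
  integrations.\<close>

lemma (in real_distribution) measure_Ioc_eq_inversion_integral:
  assumes int: "integrable lborel (char M)"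
    and ab: "a \<le> b" and a0: "measure M {a} = 0" and b0: "measure M {b} = 0"
  shows "complex_of_real (measure M {a<..b}) =
    (\<integral>x. indicator {a..b} x *\<^sub>R ((\<integral>\<theta>. iexp (- (\<theta> * x)) * char M \<theta> \<partial>lborel) / (2 * pi)) \<partial>lborel)"
proof -
  \<comment> \<open>At \<open>\<theta> = 0\<close> division by zero gives the value 0 instead of the
    limit \<open>b - a\<close>. The bound on the norm still holds there, and the point is a null
    set.\<close>
  define K where "K \<theta> = (iexp (- (\<theta> * a)) - iexp (- (\<theta> * b))) / (\<i> * complex_of_real \<theta>)" for \<theta> :: real
  have [measurable]: "char M \<in> borel_measurable borel" using int by auto
  have [measurable]: "K \<in> borel_measurable borel" unfolding K_def by measurable
  have normK: "norm (K \<theta>) \<le> b - a" for \<theta>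
  proof (cases "\<theta> = 0")
    case False
    then show ?thesis
      using Levy_Inversion_aux2[OF ab, of "- \<theta>"] by (simp add: K_def norm_minus_commute norm_divide)
  qed (use ab in \<open>simp add: K_def\<close>)
  have intK: "integrable lborel (\<lambda>\<theta>. K \<theta> * char M \<theta>)"
    by (rule Bochner_Integration.integrable_bound[OF integrable_mult_right[OF integrable_norm[OF int], of "b - a"]])
       (auto simp: norm_mult ab intro!: mult_mono normK order_trans[OF normK])
  have "(\<lambda>T::nat. \<integral>\<theta>. indicator {- real T..real T} \<theta> *\<^sub>R (K \<theta> * char M \<theta>) \<partial>lborel)
      \<longlonglongrightarrow> (\<integral>\<theta>. K \<theta> * char M \<theta> \<partial>lborel)"
  proof (rule integral_dominated_convergence[OF _ _ integrable_norm[OF intK]])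
    show "AE \<theta> in lborel. (\<lambda>T. indicator {- real T..real T} \<theta> *\<^sub>R (K \<theta> * char M \<theta>)) \<longlonglongrightarrow> K \<theta> * char M \<theta>"
    proof (rule AE_I2)
      fix \<theta> :: real
      obtain n :: nat where n: "\<bar>\<theta>\<bar> \<le> real n" using real_arch_simple by blast
      have "\<forall>\<^sub>F T in sequentially. indicator {- real T..real T} \<theta> *\<^sub>R (K \<theta> * char M \<theta>) = K \<theta> * char M \<theta>"
        using eventually_ge_at_top[of n] by eventually_elim (use n in \<open>auto simp: indicator_def\<close>)
      then show "(\<lambda>T. indicator {- real T..real T} \<theta> *\<^sub>R (K \<theta> * char M \<theta>)) \<longlonglongrightarrow> K \<theta> * char M \<theta>"
        by (rule tendsto_eventually)
    qed
  qed (auto simp: indicator_def)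
  then have "(\<lambda>T::nat. 1 / (2 * pi) * (CLBINT t=- real T..real T. K t * char M t))
      \<longlonglongrightarrow> 1 / (2 * pi) * (\<integral>\<theta>. K \<theta> * char M \<theta> \<partial>lborel)"
    by (intro tendsto_mult tendsto_const) (simp add: interval_integral_Icc set_lebesgue_integral_def)
  moreover have "(\<lambda>T::nat. 1 / (2 * pi) * (CLBINT t=- real T..real T. K t * char M t))
      \<longlonglongrightarrow> measure M {a<..b}"
    using Levy_Inversion[OF ab a0 b0] by (simp add: K_def)
  ultimately have "complex_of_real (measure M {a<..b}) = 1 / (2 * pi) * (\<integral>\<theta>. K \<theta> * char M \<theta> \<partial>lborel)"
    using LIMSEQ_unique by blast
  also have "(\<integral>\<theta>. K \<theta> * char M \<theta> \<partial>lborel) =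
      (\<integral>\<theta>. (\<integral>x. indicator {a..b} x *\<^sub>R (iexp (- (\<theta> * x)) * char M \<theta>) \<partial>lborel) \<partial>lborel)"
  proof (rule integral_cong_AE)
    show "AE \<theta> in lborel. K \<theta> * char M \<theta> =
        (\<integral>x. indicator {a..b} x *\<^sub>R (iexp (- (\<theta> * x)) * char M \<theta>) \<partial>lborel)"
      using AE_lborel_singleton[of 0]
    proof eventually_elim
      case (elim \<theta>)
      have "(\<integral>x. indicator {a..b} x *\<^sub>R iexp (- (\<theta> * x)) \<partial>lborel) =
          iexp (- (\<theta> * b)) * (\<i> / \<theta>) - iexp (- (\<theta> * a)) * (\<i> / \<theta>)"
      proof (rule integral_FTC_atLeastAtMost[OF ab])
        fix x :: real
        have "((\<lambda>z. exp (- (\<i> * (\<theta> * z))) * (\<i> / \<theta>)) has_field_derivative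
            exp (- (\<i> * (\<theta> * of_real x)))) (at (of_real x))"
          using elim by (auto intro!: derivative_eq_intros)
        from has_vector_derivative_real_field[OF this, of "{a..b}"]
        show "((\<lambda>x. iexp (- (\<theta> * x)) * (\<i> / \<theta>)) has_vector_derivative iexp (- (\<theta> * x))) (at x within {a..b})"
          by simp
      qed (intro continuous_intros)
      also have "\<dots> = K \<theta>" using elim by (simp add: K_def field_simps)
      finally have "K \<theta> * char M \<theta> = (\<integral>x. indicator {a..b} x *\<^sub>R iexp (- (\<theta> * x)) \<partial>lborel) * char M \<theta>"
        by simp
      then show ?case by (simp flip: integral_mult_left_zero)
    qed
  qed measurable
  also have "\<dots> = (\<integral>x. (\<integral>\<theta>. indicator {a..b} x *\<^sub>R (iexp (- (\<theta> * x)) * char M \<theta>) \<partial>lborel) \<partial>lborel)"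
  proof (rule lborel_pair.Fubini_integral[symmetric])
    show "integrable (lborel \<Otimes>\<^sub>M lborel)
        (\<lambda>(\<theta>, x). indicator {a..b} x *\<^sub>R (iexp (- (\<theta> * x)) * char M \<theta>))"
    proof (rule lborel_pair.Fubini_integrable)
      have "(\<lambda>\<theta>. \<integral>x. norm (indicator {a..b} x *\<^sub>R (iexp (- (\<theta> * x)) * char M \<theta>)) \<partial>lborel) =
          (\<lambda>\<theta>. (b - a) * norm (char M \<theta>))"
        using ab by (simp add: norm_mult)
      then show "integrable lborel (\<lambda>\<theta>. \<integral>x. norm (case (\<theta>, x) of (\<theta>, x) \<Rightarrow>
          indicator {a..b} x *\<^sub>R (iexp (- (\<theta> * x)) * char M \<theta>)) \<partial>lborel)"
        using int by simp
      show "AE \<theta> in lborel. integrable lborel (\<lambda>x. case (\<theta>, x) of (\<theta>, x) \<Rightarrow>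
          indicator {a..b} x *\<^sub>R (iexp (- (\<theta> * x)) * char M \<theta>))"
      proof (rule AE_I2)
        fix \<theta> :: real
        have "set_integrable lborel {a..b} (\<lambda>x. iexp (- (\<theta> * x)) * char M \<theta>)"
          by (intro borel_integrable_atLeastAtMost' continuous_intros)
        then show "integrable lborel (\<lambda>x. case (\<theta>, x) of (\<theta>, x) \<Rightarrow>
          indicator {a..b} x *\<^sub>R (iexp (- (\<theta> * x)) * char M \<theta>))" by (simp add: set_integrable_def)
      qed
    qed measurable
  qed
  finally show ?thesis by (simp flip: integral_mult_right_zero)
qed

text \<open>The preceding formula covers half-open intervals whose endpoints are not atoms.
  Boundedness of the candidate density excludes atoms, its continuity together with nonnegative
  interval masses gives its sign, and half-open intervals generate the Borel sets.\<close>

lemma (in real_distribution)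
  assumes int: "integrable lborel (char M)"
  defines "g \<equiv> \<lambda>x. Re ((\<integral>\<theta>. iexp (- (\<theta> * x)) * char M \<theta> \<partial>lborel) / (2 * pi))"
  shows inversion_density_nonneg: "\<And>x. 0 \<le> g x"
    and density_inversion_formula: "M = density lborel (\<lambda>x. ennreal (g x))"
proof -
  define G where "G x = (\<integral>\<theta>. iexp (- (\<theta> * x)) * char M \<theta> \<partial>lborel) / (2 * pi)" for x
  define B where "B = (\<integral>\<theta>. norm (char M \<theta>) \<partial>lborel) / (2 * pi)"
  have g: "g x = Re (G x)" for x by (simp add: g_def G_def)
  have [measurable]: "char M \<in> borel_measurable borel" using int by auto
  have B: "norm (G x) \<le> B" for x
  proof -
    have "norm (\<integral>\<theta>. iexp (- (\<theta> * x)) * char M \<theta> \<partial>lborel) \<le>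
        (\<integral>\<theta>. norm (iexp (- (\<theta> * x)) * char M \<theta>) \<partial>lborel)" by (rule integral_norm_bound)
    then show ?thesis by (simp add: G_def B_def norm_mult norm_divide divide_right_mono)
  qed
  have B0: "0 \<le> B" using B[of 0] norm_ge_zero order_trans by blast
  have contG: "continuous_on UNIV G"
  proof -
    have "isCont (\<lambda>x. \<integral>\<theta>. iexp (- (\<theta> * x)) * char M \<theta> \<partial>lborel) x" for x
      unfolding continuous_at_sequentially comp_def
    proof (intro allI impI)
      fix X assume X: "X \<longlonglongrightarrow> x"
      show "(\<lambda>n. \<integral>\<theta>. iexp (- (\<theta> * X n)) * char M \<theta> \<partial>lborel)
          \<longlonglongrightarrow> (\<integral>\<theta>. iexp (- (\<theta> * x)) * char M \<theta> \<partial>lborel)"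
        by (rule integral_dominated_convergence[OF _ _ integrable_norm[OF int]])
           (auto simp: norm_mult intro!: tendsto_intros X)
    qed
    then show ?thesis unfolding G_def by (intro continuous_intros) (simp_all add: continuous_at_imp_continuous_on)
  qed
  then have contg: "continuous_on UNIV g" unfolding g by (intro continuous_intros)
  have intG: "integrable lborel (\<lambda>x. indicator {a..b} x *\<^sub>R G x)" for a b
    using borel_integrable_atLeastAtMost'[OF continuous_on_subset[OF contG]]
    by (simp add: set_integrable_def)
  \<comment> \<open>There are only countably many atoms, so \<open>x\<close> lies in arbitrarily
    short intervals with atom-free endpoints. Such an interval has mass at most its length times
    \<open>B\<close>; the choice of \<open>d\<close> uses \<open>B + 1\<close> to avoid dividing by
    zero.\<close>
  have atomless: "measure M {x} = 0" for x
  proof (rule antisym)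
    show "measure M {x} \<le> 0"
    proof (rule field_le_epsilon)
      fix e :: real assume e: "0 < e"
      define d where "d = e / (2 * (B + 1))"
      have d: "0 < d" using e B0 by (simp add: d_def)
      obtain a where a: "x - d < a" "a < x" "measure M {a} = 0"
        using real_interval_avoid_countable_set[OF _ countable_support, of "x - d" x] d by auto
      obtain b where b: "x < b" "b < x + d" "measure M {b} = 0"
        using real_interval_avoid_countable_set[OF _ countable_support, of x "x + d"] d by auto
      have "measure M {x} \<le> measure M {a<..b}"
        using a b by (intro finite_measure_mono) auto
      also have "\<dots> = norm (complex_of_real (measure M {a<..b}))" by simp
      also have "\<dots> = norm (\<integral>x. indicator {a..b} x *\<^sub>R G x \<partial>lborel)"
        using a b unfolding G_def
        by (intro arg_cong[where f = norm] measure_Ioc_eq_inversion_integral[OF int]) auto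
      also have "\<dots> \<le> (\<integral>x. norm (indicator {a..b} x *\<^sub>R G x) \<partial>lborel)" by (rule integral_norm_bound)
      also have "\<dots> \<le> (\<integral>x. indicator {a..b} x * B \<partial>lborel)"
      proof (rule integral_mono[OF integrable_norm[OF intG]])
        show "norm (indicator {a..b} x *\<^sub>R G x) \<le> indicator {a..b} x * B" for x
          using B by (simp add: indicator_def)
      qed (use a b in simp)
      also have "\<dots> = (b - a) * B" using a b by simp
      also have "\<dots> \<le> (2 * d) * (B + 1)" using a b B0 by (intro mult_mono) auto
      also have "\<dots> = e"
        using nonzero_divide_mult_cancel_right[of "B + 1" e] B0 by (simp add: d_def field_simps)
      finally show "measure M {x} \<le> 0 + e" by simp
    qed
  qed simp
  have meas: "measure M {a<..b} = (\<integral>x. indicator {a..b} x * g x \<partial>lborel)" if "a \<le> b" for a b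
  proof -
    have "complex_of_real (measure M {a<..b}) = (\<integral>x. indicator {a..b} x *\<^sub>R G x \<partial>lborel)"
      using measure_Ioc_eq_inversion_integral[OF int that atomless atomless] by (simp add: G_def)
    then have "measure M {a<..b} = Re (\<integral>x. indicator {a..b} x *\<^sub>R G x \<partial>lborel)"
      by (metis Re_complex_of_real)
    also have "\<dots> = (\<integral>x. Re (indicator {a..b} x *\<^sub>R G x) \<partial>lborel)"
      using integral_Re[OF intG] by simp
    finally show ?thesis by (simp add: g)
  qed
  have intg: "integrable lborel (\<lambda>x. indicator {a..b} x * g x)" for a b
    using borel_integrable_atLeastAtMost'[OF continuous_on_subset[OF contg]]
    by (simp add: set_integrable_def)
  \<comment> \<open>If \<open>g x\<close> were negative, then \<open>g\<close> would stay below
    \<open>g x / 2\<close> on a short interval to the right of \<open>x\<close>, and that interval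
    would have negative mass.\<close>
  show nonneg: "0 \<le> g x" for x
  proof (rule ccontr)
    assume "\<not> 0 \<le> g x"
    then have neg: "g x < 0" by simp
    have "isCont g x" using contg by (simp add: continuous_on_eq_continuous_at)
    then obtain d where d: "d > 0" "\<And>y. \<bar>y - x\<bar> < d \<Longrightarrow> \<bar>g y - g x\<bar> < - g x / 2"
      using neg unfolding continuous_at_eps_delta dist_real_def
      by (metis divide_pos_pos neg_0_less_iff_less zero_less_numeral)
    have "0 \<le> measure M {x<..x + d / 2}" by simp
    also have "\<dots> = (\<integral>y. indicator {x..x + d / 2} y * g y \<partial>lborel)" using d(1) by (intro meas) auto
    also have "\<dots> \<le> (\<integral>y. indicator {x..x + d / 2} y * (g x / 2) \<partial>lborel)"
    proof (rule integral_mono[OF intg])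
      show "indicator {x..x + d / 2} y * g y \<le> indicator {x..x + d / 2} y * (g x / 2)" for y
      proof (cases "y \<in> {x..x + d / 2}")
        case True
        then have "\<bar>y - x\<bar> < d" using d(1) by (auto simp: abs_if)
        from d(2)[OF this] have "g y \<le> g x / 2" by (simp add: abs_if split: if_splits)
        then show ?thesis using True by simp
      qed simp
    qed (use d(1) in simp)
    also have "\<dots> = d / 2 * (g x / 2)" using d(1) by simp
    also have "\<dots> < 0" using neg d(1) by (simp add: mult_pos_neg)
    finally show False by simp
  qed
  have [measurable]: "g \<in> borel_measurable borel" using contg by (rule borel_measurable_continuous_onI)
  show "M = density lborel (\<lambda>x. ennreal (g x))"
  proof (rule measure_eqI_generator_eq[where E = "range (\<lambda>(a, b). {a<..b::real})" and \<Omega> = UNIV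
        and A = "\<lambda>i::nat. {- real i<..real i}"])
    show "Int_stable (range (\<lambda>(a, b). {a<..b::real}))"
      by (auto simp: Int_stable_def image_iff)
    show "emeasure M X = emeasure (density lborel (\<lambda>x. ennreal (g x))) X"
      if "X \<in> range (\<lambda>(a, b). {a<..b::real})" for X
    proof -
      obtain a b where X: "X = {a<..b}" using \<open>X \<in> _\<close> by auto
      show ?thesis
      proof (cases "a \<le> b")
        case True
        have "emeasure (density lborel (\<lambda>x. ennreal (g x))) X =
            (\<integral>\<^sup>+x. ennreal (g x) * indicator {a<..b} x \<partial>lborel)" by (simp add: X emeasure_density)
        also have "\<dots> = (\<integral>\<^sup>+x. ennreal (indicator {a..b} x * g x) \<partial>lborel)"
          by (rule nn_integral_cong_AE, use AE_lborel_singleton[of a] in eventually_elim)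
             (auto simp: indicator_def)
        also have "\<dots> = ennreal (\<integral>x. indicator {a..b} x * g x \<partial>lborel)"
          using intg nonneg by (intro nn_integral_eq_integral) auto
        also have "\<dots> = emeasure M X" using meas[OF True] by (simp add: X emeasure_eq_measure)
        finally show ?thesis by simp
      qed (simp add: X)
    qed
    show "(\<Union>i::nat. {- real i<..real i}) = UNIV"
    proof (intro set_eqI iffI UNIV_I UN_I)
      fix x :: real
      show "x \<in> {- real (nat \<lceil>\<bar>x\<bar> + 1\<rceil>)<..real (nat \<lceil>\<bar>x\<bar> + 1\<rceil>)}" by simp linarith
    qed
  qed (auto simp: borel_sigma_sets_Ioc emeasure_eq_measure)
qed

section \<open>Bromwich integrals\<close>

lemma integrable_inverse_1_plus_square_lborel: "integrable lborel (\<lambda>x::real. 1 / (1 + x\<^sup>2))"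
  using integrable_inverse_1_plus_square by (simp add: set_integrable_def inverse_eq_divide)

text \<open>A single term of the exponential series suffices:
  \<open>y ^ n / fact n \<le> exp y\<close> with \<open>y = \<kappa> * r powr b\<close> and
  \<open>n\<close> so large that \<open>b * n\<close> exceeds \<open>a + 2\<close>. This gives
  \<open>C = fact n / \<kappa> ^ n\<close>.\<close>

lemma powr_mult_exp_decay:
  fixes a b \<kappa> :: real
  assumes b: "0 < b" and \<kappa>: "0 < \<kappa>"
  obtains C where "\<And>r. 1 \<le> r \<Longrightarrow> r powr a * exp (- \<kappa> * r powr b) \<le> C / r\<^sup>2"
proof -
  obtain n :: nat where n: "(a + 2) / b < real n" using reals_Archimedean2 by blast
  have "r powr a * exp (- \<kappa> * r powr b) \<le> (fact n / \<kappa> ^ n) / r\<^sup>2" if r: "1 \<le> r" for r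
  proof -
    let ?y = "\<kappa> * r powr b"
    have y: "0 < ?y" using \<kappa> r by simp
    have "r powr (a + 2) \<le> r powr (b * real n)"
      using n b r by (intro powr_mono) (auto simp: field_simps)
    also have "\<dots> = (r powr b) ^ n"
      using r by (simp add: powr_powr[symmetric] powr_realpow)
    finally have *: "\<kappa> ^ n * r powr (a + 2) \<le> ?y ^ n" using \<kappa> by (simp add: power_mult_distrib)
    have "?y ^ n / fact n \<le> exp ?y"
    proof -
      have "(\<Sum>k\<in>{n}. ?y ^ k /\<^sub>R fact k) \<le> (\<Sum>k. ?y ^ k /\<^sub>R fact k)"
        using y by (intro sum_le_suminf summable_exp_generic) auto
      then show ?thesis by (simp add: exp_def field_simps)
    qed
    then have "?y ^ n \<le> fact n * exp ?y" by (simp add: field_simps)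
    with * have "\<kappa> ^ n * r powr (a + 2) \<le> fact n * exp ?y" by linarith
    moreover have "r powr (a + 2) = r powr a * r\<^sup>2" using r by (simp add: powr_add)
    ultimately have "\<kappa> ^ n * (r powr a * r\<^sup>2) \<le> fact n * exp ?y" by simp
    then show ?thesis using r \<kappa> y by (simp add: exp_minus field_simps)
  qed
  then show ?thesis using that by blast
qed

text \<open>On the line the squared modulus is \<open>1 + \<theta>\<^sup>2\<close>, so the decay
  \<open>C / r\<^sup>2\<close> becomes a multiple of the integrable function
  \<open>1 / (1 + \<theta>\<^sup>2)\<close>.\<close>

lemma integrable_vertical_line:
  fixes a b \<kappa> :: real
  assumes "0 < b" and "0 < \<kappa>"
  shows "integrable lborel
    (\<lambda>\<theta>. norm (Complex 1 \<theta>) powr a * exp (- \<kappa> * norm (Complex 1 \<theta>) powr b))"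
proof -
  obtain C where C: "\<And>r. 1 \<le> r \<Longrightarrow> r powr a * exp (- \<kappa> * r powr b) \<le> C / r\<^sup>2"
    using powr_mult_exp_decay[OF assms] by blast
  have n: "norm (Complex 1 \<theta>) = sqrt (1 + \<theta>\<^sup>2)" for \<theta> by (simp add: cmod_def)
  show ?thesis
  proof (rule Bochner_Integration.integrable_bound)
    show "integrable lborel (\<lambda>\<theta>::real. C * (1 / (1 + \<theta>\<^sup>2)))"
      using integrable_inverse_1_plus_square_lborel by (rule integrable_mult_right)
    show "AE \<theta> in lborel. norm (norm (Complex 1 \<theta>) powr a * exp (- \<kappa> * norm (Complex 1 \<theta>) powr b))
        \<le> norm (C * (1 / (1 + \<theta>\<^sup>2)))"
    proof (rule AE_I2)
      fix \<theta> :: real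
      show "norm (norm (Complex 1 \<theta>) powr a * exp (- \<kappa> * norm (Complex 1 \<theta>) powr b))
        \<le> norm (C * (1 / (1 + \<theta>\<^sup>2)))"
        using C[of "norm (Complex 1 \<theta>)"] abs_ge_self[of "C / (1 + \<theta>\<^sup>2)"] by (simp add: n del: abs_divide)
    qed
    show "(\<lambda>\<theta>. norm (Complex 1 \<theta>) powr a * exp (- \<kappa> * norm (Complex 1 \<theta>) powr b))
      \<in> borel_measurable lborel" unfolding n by measurable
  qed
qed

text \<open>The power has modulus \<open>norm s powr a\<close> and argument
  \<open>a * Im (Ln s)\<close>, where the imaginary part is below \<pi>/2 in absolute value. The
  bound \<open>a \<le> 2\<close> keeps the angle within [0, \<pi>], where the cosine
  decreases.\<close>

lemma Re_powr_ge:
  assumes s: "0 < Re s" and a: "0 \<le> a" "a \<le> 2"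
  shows "norm s powr a * cos (a * pi / 2) \<le> Re (s powr complex_of_real a)"
proof -
  have s0: "s \<noteq> 0" using s by auto
  have "\<bar>Im (Ln s)\<bar> < pi / 2" using s by (rule Re_Ln_pos_lt_imp)
  then have "a * \<bar>Im (Ln s)\<bar> \<le> a * (pi / 2)" using a by (intro mult_left_mono) auto
  moreover have "a * (pi / 2) \<le> 2 * (pi / 2)" using a by (intro mult_right_mono) auto
  ultimately have "cos (a * (pi / 2)) \<le> cos (a * \<bar>Im (Ln s)\<bar>)"
    using a by (intro cos_monotone_0_pi_le) auto
  also have "\<dots> = cos (a * Im (Ln s))" by (simp add: abs_if)
  finally have "norm s powr a * cos (a * pi / 2) \<le> norm s powr a * cos (a * Im (Ln s))"
    by (intro mult_left_mono) auto
  also have "\<dots> = Re (s powr complex_of_real a)"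
    using s0 by (simp add: powr_def Re_exp)
  finally show ?thesis .
qed

lemma line_notin_nonpos_Reals [simp]: "Complex 1 \<theta> \<notin> \<real>\<^sub>\<le>\<^sub>0"
  by (simp add: complex_nonpos_Reals_iff)

lemma line_nonzero [simp]: "Complex 1 \<theta> \<noteq> 0"
  by (simp add: complex_eq_iff)

lemma continuous_on_line: "continuous_on A (\<lambda>\<theta>. Complex 1 \<theta>)"
  by (simp add: Complex_eq) (intro continuous_intros)

lemma has_real_derivative_Re:
  assumes "(f has_vector_derivative D) (at x)"
  shows "((\<lambda>x. Re (f x)) has_real_derivative Re D) (at x)"
  using bounded_linear.has_vector_derivative[OF bounded_linear_Re assms]
  by (simp add: has_real_derivative_iff_has_vector_derivative)

text \<open>A point of \<open>S\<close> where \<open>f\<close> and \<open>g\<close> differ would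
  have a whole interval of such points around it, which is not a null set; continuity then reaches
  the closure. With \<open>S\<close> an open half-line, the boundary point 0 is included.\<close>

lemma AE_eq_continuous_imp_eq_closure:
  fixes f g :: "real \<Rightarrow> real"
  assumes S: "open S" and f: "continuous_on (closure S) f" and g: "continuous_on (closure S) g"
    and ae: "AE x in lborel. x \<in> S \<longrightarrow> f x = g x" and x: "x \<in> closure S"
  shows "f x = g x"
proof -
  have cont: "continuous_on (closure S) (\<lambda>x. f x - g x)" using f g by (intro continuous_intros)
  have "f x - g x = 0" if x: "x \<in> S" for x
  proof (rule ccontr)
    assume "f x - g x \<noteq> 0"
    then obtain e1 where e1: "e1 > 0" "\<forall>y. dist x y < e1 \<longrightarrow> f y - g y \<noteq> 0 \<or> y \<notin> S"
      using continuous_on_avoid[OF continuous_on_subset[OF cont closure_subset] x] by metis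
    obtain e2 where e2: "e2 > 0" "ball x e2 \<subseteq> S" using S x open_contains_ball by blast
    define e where "e = min e1 e2"
    have e: "e > 0" using e1 e2 by (simp add: e_def)
    have "AE y in lborel. y \<notin> {x - e<..<x + e}"
      using ae
    proof eventually_elim
      case (elim y)
      show ?case
      proof
        assume "y \<in> {x - e<..<x + e}"
        then have "dist x y < e" by (auto simp: dist_real_def abs_if)
        then show False using elim e1 e2 by (auto simp: e_def subset_eq)
      qed
    qed
    then have "emeasure lborel {x - e<..<x + e} = 0"
      by (subst (asm) AE_iff_measurable[where N = "{x - e<..<x + e}"]) auto
    then show False using e by simp
  qed
  then have "f x - g x = 0" by (rule continuous_constant_on_closure[OF cont]) (use x in auto)
  then show ?thesis by simp
qed

section \<open>The Laplace exponent and the Bromwich kernel\<close>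

locale fractional_exponent =
  fixes \<nu> lam :: real
  assumes nu_pos: "0 < \<nu>" and nu_less: "\<nu> < 1 / 2" and lam_pos: "0 < lam"
begin

definition \<psi> :: "complex \<Rightarrow> complex" where
  "\<psi> s = s powr of_real (2 * \<nu>) + of_real (2 * lam) * s powr of_real \<nu>"

text \<open>The parametrisation \<open>s = 1 + i\<theta>\<close> of the Bromwich line, with \<open>ds = i d\<theta>\<close>; the integral over
  \<open>\<theta>\<close> is real by symmetry, so only the real part is kept.  \<open>bromwich a x t\<close> is \<open>J\<^sub>a(x,t)\<close>.\<close>

definition kern :: "real \<Rightarrow> real \<Rightarrow> real \<Rightarrow> real \<Rightarrow> complex" where
  "kern a x t \<theta> = exp (of_real x * Complex 1 \<theta>) * Complex 1 \<theta> powr of_real a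
     * exp (- of_real t * \<psi> (Complex 1 \<theta>))"

definition bromwich :: "real \<Rightarrow> real \<Rightarrow> real \<Rightarrow> real" where
  "bromwich a x t = (\<integral>\<theta>. Re (kern a x t \<theta>) \<partial>lborel) / (2 * pi)"

lemma holomorphic_psi: "\<psi> holomorphic_on {s. 0 < Re s}"
  unfolding \<psi>_def by (intro holomorphic_intros) (auto simp: complex_nonpos_Reals_iff)

lemma psi_of_real:
  "0 \<le> \<mu> \<Longrightarrow> \<psi> (of_real \<mu>) = of_real (\<mu> powr (2 * \<nu>) + 2 * lam * \<mu> powr \<nu>)"
  using powr_of_real[of \<mu> "2 * \<nu>"] powr_of_real[of \<mu> \<nu>] by (simp add: \<psi>_def)

lemma cos_pos: "0 < cos (\<nu> * pi)"
  using nu_pos nu_less by (intro cos_gt_zero_pi) (auto simp: field_simps intro: less_trans[of _ 0])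

text \<open>For \<nu> < 1/2 the argument of \<open>s powr (2 * \<nu>)\<close> stays below \<nu>\<pi>
  < \<pi>/2 in absolute value, which yields a positive constant. The term with \<open>lam\<close>
  has nonnegative real part and is dropped from the bound.\<close>

lemma Re_psi_ge:
  assumes "0 < Re s"
  shows "cos (\<nu> * pi) * norm s powr (2 * \<nu>) \<le> Re (\<psi> s)"
proof -
  have "0 \<le> norm s powr \<nu> * cos (\<nu> * pi / 2)"
    using nu_pos nu_less
    by (intro mult_nonneg_nonneg cos_ge_zero) (auto simp: field_simps intro: order_trans[of _ 0])
  also have "\<dots> \<le> Re (s powr complex_of_real \<nu>)"
    using Re_powr_ge[OF assms, of \<nu>] nu_pos nu_less by simp
  finally have "0 \<le> 2 * lam * Re (s powr complex_of_real \<nu>)" using lam_pos by simp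
  moreover have "norm s powr (2 * \<nu>) * cos (\<nu> * pi) \<le> Re (s powr complex_of_real (2 * \<nu>))"
    using Re_powr_ge[OF assms, of "2 * \<nu>"] nu_pos nu_less by simp
  moreover have "Re (\<psi> s) = Re (s powr complex_of_real (2 * \<nu>)) + 2 * lam * Re (s powr complex_of_real \<nu>)"
    by (simp add: \<psi>_def)
  ultimately have "norm s powr (2 * \<nu>) * cos (\<nu> * pi) \<le> Re (\<psi> s)" by linarith
  then show ?thesis by (simp only: mult.commute)
qed

lemma continuous_on_kern: "continuous_on A (kern a x t)"
  unfolding kern_def \<psi>_def
  by (intro continuous_intros continuous_on_line) auto

lemma measurable_kern [measurable]: "kern a x t \<in> borel_measurable borel"
  by (rule borel_measurable_continuous_onI[OF continuous_on_kern])

text \<open>The bound is uniform over all \<open>x \<le> x0\<close> and all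
  \<open>t \<ge> t0\<close>, so it can serve as the dominating function when differentiating in
  either variable.\<close>

lemma norm_kern_le:
  assumes "0 \<le> t0" "t0 \<le> t" "x \<le> x0"
  shows "norm (kern a x t \<theta>) \<le> exp x0 * (norm (Complex 1 \<theta>) powr a
     * exp (- (t0 * cos (\<nu> * pi)) * norm (Complex 1 \<theta>) powr (2 * \<nu>)))"
proof -
  let ?s = "Complex 1 \<theta>"
  have psi: "cos (\<nu> * pi) * norm ?s powr (2 * \<nu>) \<le> Re (\<psi> ?s)" by (rule Re_psi_ge) simp
  have "t0 * (cos (\<nu> * pi) * norm ?s powr (2 * \<nu>)) \<le> t * Re (\<psi> ?s)"
    using assms psi cos_pos by (intro mult_mono) auto
  then have "exp (- (t * Re (\<psi> ?s))) \<le> exp (- (t0 * cos (\<nu> * pi)) * norm ?s powr (2 * \<nu>))"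
    by (simp add: mult.assoc)
  moreover have "norm (kern a x t \<theta>) = exp x * (norm ?s powr a * exp (- (t * Re (\<psi> ?s))))"
    by (simp add: kern_def norm_mult norm_powr_real_powr')
  ultimately show ?thesis using assms by (auto intro!: mult_mono)
qed

lemma integrable_kern_bound:
  "0 < t \<Longrightarrow> integrable lborel (\<lambda>\<theta>. norm (Complex 1 \<theta>) powr a
     * exp (- (t * cos (\<nu> * pi)) * norm (Complex 1 \<theta>) powr (2 * \<nu>)))"
  using nu_pos cos_pos by (intro integrable_vertical_line) auto

lemma integrable_kern: "0 < t \<Longrightarrow> integrable lborel (kern a x t)"
  by (rule Bochner_Integration.integrable_bound[OF
        integrable_mult_right[OF integrable_kern_bound[of t a], of "exp x"]])
     (use norm_kern_le[of t t x x a] in auto)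

text \<open>Powers of \<open>s\<close> act by shifting the index. Hence differentiation in
  \<open>x\<close>, the factor \<open>\<psi>\<close> from differentiation in \<open>t\<close>, and
  the fractional integral all stay within the family \<open>kern\<close>.\<close>

lemma kern_mult_line: "kern a x t \<theta> * Complex 1 \<theta> powr of_real b = kern (a + b) x t \<theta>"
  by (simp add: kern_def powr_add)

lemma kern_mult_psi:
  "kern a x t \<theta> * \<psi> (Complex 1 \<theta>) = kern (a + 2 * \<nu>) x t \<theta> + of_real (2 * lam) * kern (a + \<nu>) x t \<theta>"
  by (simp add: \<psi>_def distrib_left kern_mult_line[symmetric] del: of_real_mult)

lemma kern_deriv_x: "((\<lambda>x. Re (kern a x t \<theta>)) has_real_derivative Re (kern (a + 1) x t \<theta>)) (at x)"
proof (rule has_real_derivative_Re)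
  \<comment> \<open>The real variable \<open>x\<close> is replaced by a complex \<open>z\<close>, so
    that the complex derivative rules apply; restriction to the real axis then gives the vector
    derivative.\<close>
  have "((\<lambda>z. exp (z * Complex 1 \<theta>) * Complex 1 \<theta> powr of_real a * exp (- of_real t * \<psi> (Complex 1 \<theta>)))
      has_field_derivative kern (a + 1) x t \<theta>) (at (of_real x))"
    unfolding kern_mult_line[of a x t \<theta> 1, symmetric]
    by (auto intro!: derivative_eq_intros simp: kern_def)
  from has_vector_derivative_real_field[OF this, of UNIV]
  show "((\<lambda>x. kern a x t \<theta>) has_vector_derivative kern (a + 1) x t \<theta>) (at x)"
    by (simp add: kern_def)
qed

lemma kern_deriv_t:
  "((\<lambda>t. Re (kern a x t \<theta>)) has_real_derivative
     - Re (kern (a + 2 * \<nu>) x t \<theta>) - 2 * lam * Re (kern (a + \<nu>) x t \<theta>)) (at t)"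
proof -
  have "((\<lambda>t. Re (kern a x t \<theta>)) has_real_derivative Re (- (kern a x t \<theta> * \<psi> (Complex 1 \<theta>)))) (at t)"
  proof (rule has_real_derivative_Re)
    have "((\<lambda>z. exp (of_real x * Complex 1 \<theta>) * Complex 1 \<theta> powr of_real a * exp (- z * \<psi> (Complex 1 \<theta>)))
        has_field_derivative - (kern a x t \<theta> * \<psi> (Complex 1 \<theta>))) (at (of_real t))"
      by (auto intro!: derivative_eq_intros simp: kern_def)
    from has_vector_derivative_real_field[OF this, of UNIV]
    show "((\<lambda>t. kern a x t \<theta>) has_vector_derivative - (kern a x t \<theta> * \<psi> (Complex 1 \<theta>))) (at t)"
      by (simp add: kern_def)
  qed
  then show ?thesis by (simp add: kern_mult_psi)
qed

section \<open>Differentiation of the Bromwich integrals in \<open>x\<close> and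
  \<open>t\<close>\<close>

lemma bromwich_deriv_x:
  assumes t: "0 < t"
  shows "((\<lambda>x. bromwich a x t) has_real_derivative bromwich (a + 1) x t) (at x)"
proof -
  have "((\<lambda>x. \<integral>\<theta>. Re (kern a x t \<theta>) \<partial>lborel) has_real_derivative
      (\<integral>\<theta>. Re (kern (a + 1) x t \<theta>) \<partial>lborel)) (at x)"
  proof (rule has_field_derivative_lebesgue_integral[where r = 1])
    show "integrable lborel (\<lambda>\<theta>. Re (kern a z t \<theta>))" for z using integrable_kern[OF t] by simp
    show "integrable lborel (\<lambda>\<theta>. exp (x + 1) * (norm (Complex 1 \<theta>) powr (a + 1)
        * exp (- (t * cos (\<nu> * pi)) * norm (Complex 1 \<theta>) powr (2 * \<nu>))))"
      using integrable_kern_bound[OF t] by (rule integrable_mult_right)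
    show "AE \<theta> in lborel. \<forall>z\<in>ball x 1.
        ((\<lambda>z. Re (kern a z t \<theta>)) has_real_derivative Re (kern (a + 1) z t \<theta>)) (at z) \<and>
        norm (Re (kern (a + 1) z t \<theta>)) \<le> exp (x + 1) * (norm (Complex 1 \<theta>) powr (a + 1)
          * exp (- (t * cos (\<nu> * pi)) * norm (Complex 1 \<theta>) powr (2 * \<nu>)))"
    proof (intro AE_I2 ballI conjI kern_deriv_x)
      fix \<theta> z assume "z \<in> ball x 1"
      then have z: "z \<le> x + 1" by (auto simp: dist_real_def)
      have "norm (Re (kern (a + 1) z t \<theta>)) \<le> norm (kern (a + 1) z t \<theta>)"
        using abs_Re_le_cmod by simp
      also have "\<dots> \<le> exp (x + 1) * (norm (Complex 1 \<theta>) powr (a + 1)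
          * exp (- (t * cos (\<nu> * pi)) * norm (Complex 1 \<theta>) powr (2 * \<nu>)))"
        using t z by (intro norm_kern_le) auto
      finally show "norm (Re (kern (a + 1) z t \<theta>)) \<le> \<dots>" .
    qed
  qed (simp_all)
  from DERIV_cdivide[OF this, of "2 * pi"] show ?thesis by (simp add: bromwich_def)
qed

lemma bromwich_deriv_t:
  assumes t: "0 < t"
  shows "((\<lambda>t. bromwich a x t) has_real_derivative - (bromwich (a + 2 * \<nu>) x t + 2 * lam * bromwich (a + \<nu>) x t)) (at t)"
proof -
  \<comment> \<open>All times in the ball of radius \<open>t / 2\<close> around \<open>t\<close> are
    at least \<open>t / 2\<close>, so the decay available at time \<open>t / 2\<close> dominates the
    kernel on the whole ball.\<close>
  define bd where "bd b \<theta> = exp x * (norm (Complex 1 \<theta>) powr b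
      * exp (- (t / 2 * cos (\<nu> * pi)) * norm (Complex 1 \<theta>) powr (2 * \<nu>)))" for b \<theta>
  have int: "integrable lborel (\<lambda>\<theta>. Re (kern a x t \<theta>))" if "0 < t" for a t
    using integrable_kern[OF that] by simp
  have bd: "integrable lborel (bd b)" for b
    unfolding bd_def using integrable_kern_bound[of "t / 2"] t by (intro integrable_mult_right) simp
  have "((\<lambda>t. \<integral>\<theta>. Re (kern a x t \<theta>) \<partial>lborel) has_real_derivative
      (\<integral>\<theta>. - Re (kern (a + 2 * \<nu>) x t \<theta>) - 2 * lam * Re (kern (a + \<nu>) x t \<theta>) \<partial>lborel)) (at t)"
  proof (rule has_field_derivative_lebesgue_integral[where r = "t / 2"])
    have half: "t / 2 \<le> z" if "z \<in> ball t (t / 2)" for z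
      using that by (auto simp: dist_real_def abs_if split: if_splits)
    show "integrable lborel (\<lambda>\<theta>. Re (kern a x z \<theta>))" if "z \<in> ball t (t / 2)" for z
      using half[OF that] t by (intro int) simp
    show "integrable lborel (\<lambda>\<theta>. bd (a + 2 * \<nu>) \<theta> + 2 * lam * bd (a + \<nu>) \<theta>)"
      using bd by simp
    show "AE \<theta> in lborel. \<forall>z\<in>ball t (t / 2).
        ((\<lambda>z. Re (kern a x z \<theta>)) has_real_derivative
           - Re (kern (a + 2 * \<nu>) x z \<theta>) - 2 * lam * Re (kern (a + \<nu>) x z \<theta>)) (at z) \<and>
        norm (- Re (kern (a + 2 * \<nu>) x z \<theta>) - 2 * lam * Re (kern (a + \<nu>) x z \<theta>))
          \<le> bd (a + 2 * \<nu>) \<theta> + 2 * lam * bd (a + \<nu>) \<theta>"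
    proof (intro AE_I2 ballI conjI kern_deriv_t)
      fix \<theta> z assume z: "z \<in> ball t (t / 2)"
      have le: "\<bar>Re (kern b x z \<theta>)\<bar> \<le> bd b \<theta>" for b
        unfolding bd_def using half[OF z] t
        by (intro order_trans[OF abs_Re_le_cmod] norm_kern_le) auto
      have "2 * lam * \<bar>Re (kern (a + \<nu>) x z \<theta>)\<bar> \<le> 2 * lam * bd (a + \<nu>) \<theta>"
        using lam_pos le by (intro mult_left_mono) auto
      from add_mono[OF le[of "a + 2 * \<nu>"] this]
      show "norm (- Re (kern (a + 2 * \<nu>) x z \<theta>) - 2 * lam * Re (kern (a + \<nu>) x z \<theta>))
          \<le> bd (a + 2 * \<nu>) \<theta> + 2 * lam * bd (a + \<nu>) \<theta>"
        using lam_pos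
        by (intro order_trans[OF norm_triangle_ineq4]) (simp add: abs_mult)
    qed
  qed (use t in simp_all)
  from DERIV_cdivide[OF this, of "2 * pi"] show ?thesis
    unfolding bromwich_def by (rule DERIV_cong) (simp add: int[OF t] field_simps)
qed

lemma continuous_on_bromwich: "0 < t \<Longrightarrow> continuous_on A (\<lambda>x. bromwich a x t)"
  using bromwich_deriv_x[THEN DERIV_isCont] by (simp add: continuous_at_imp_continuous_on)

section \<open>Fractional integrals and Riemann-Liouville derivatives\<close>

text \<open>Replacing \<open>x\<close> by \<open>x - u\<close> multiplies the kernel by
  \<open>exp (- s * u)\<close>. Integrating first over \<open>u\<close> is therefore the complex
  Gamma integral with \<open>b = 1 - \<alpha>\<close>, whose factor
  \<open>s powr (\<alpha> - 1)\<close> shifts the index from 0 to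
  \<open>\<alpha> - 1\<close>.\<close>

lemma integral_kern_convolution:
  assumes \<alpha>: "0 < \<alpha>" "\<alpha> < 1" and t: "0 < t"
  shows "has_bochner_integral lborel (\<lambda>u. indicator {0<..} u * u powr (- \<alpha>) * bromwich 0 (x - u) t)
    (Gamma (1 - \<alpha>) * bromwich (\<alpha> - 1) x t)"
proof -
  define w where "w u = indicator {0<..} u * u powr (- \<alpha>)" for u :: real
  have w [measurable]: "w \<in> borel_measurable borel" unfolding w_def by measurable
  have w0: "0 \<le> w u" for u by (simp add: w_def)
  have shift: "kern 0 (x - u) t \<theta> = kern 0 x t \<theta> * exp (- Complex 1 \<theta> * of_real u)" for u \<theta>
  proof -
    have "of_real (x - u) * Complex 1 \<theta> = of_real x * Complex 1 \<theta> + - Complex 1 \<theta> * of_real u"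
      by (simp add: algebra_simps)
    then have "exp (of_real (x - u) * Complex 1 \<theta>) =
        exp (of_real x * Complex 1 \<theta>) * exp (- Complex 1 \<theta> * of_real u)"
      by (simp only: exp_add)
    then show ?thesis by (simp add: kern_def)
  qed
  have cline [measurable]: "Complex 1 \<in> borel_measurable borel"
    using continuous_on_line by (intro borel_measurable_continuous_onI)
  have wint: "has_bochner_integral lborel (\<lambda>u. w u * exp (- u)) (Gamma (1 - \<alpha>))"
    using has_bochner_integral_Gamma[of "1 - \<alpha>" 1] \<alpha> by (simp add: w_def)
  have cint: "integrable lborel (\<lambda>u. of_real (w u) * exp (- s * of_real u))"
    "(\<integral>u. of_real (w u) * exp (- s * of_real u) \<partial>lborel)
      = of_real (Gamma (1 - \<alpha>)) * s powr (of_real (\<alpha> - 1))" if "0 < Re s" for s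
    using complex_Gamma_integral[of "1 - \<alpha>" s] \<alpha> that by (simp_all add: w_def)
  define f where "f = (\<lambda>(\<theta>, u). of_real (w u) * kern 0 (x - u) t \<theta>)"
  have fm [measurable]: "f \<in> borel_measurable (lborel \<Otimes>\<^sub>M lborel)"
    unfolding f_def shift by measurable
  have f\<theta>: "integrable lborel (\<lambda>u. f (\<theta>, u))"
    "(\<integral>u. f (\<theta>, u) \<partial>lborel) = of_real (Gamma (1 - \<alpha>)) * kern (\<alpha> - 1) x t \<theta>" for \<theta>
  proof -
    have eq: "(\<lambda>u. f (\<theta>, u)) = (\<lambda>u. kern 0 x t \<theta> * (of_real (w u) * exp (- Complex 1 \<theta> * of_real u)))"
      by (simp only: f_def prod.case shift mult.left_commute)
    show "integrable lborel (\<lambda>u. f (\<theta>, u))"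
      unfolding eq by (intro integrable_mult_right cint) simp
    have "(\<integral>u. f (\<theta>, u) \<partial>lborel) =
        kern 0 x t \<theta> * (of_real (Gamma (1 - \<alpha>)) * Complex 1 \<theta> powr (of_real (\<alpha> - 1)))"
      unfolding eq using cint[of "Complex 1 \<theta>"] by simp
    then show "(\<integral>u. f (\<theta>, u) \<partial>lborel) = of_real (Gamma (1 - \<alpha>)) * kern (\<alpha> - 1) x t \<theta>"
      using kern_mult_line[of 0 x t \<theta> "\<alpha> - 1"] by (simp add: mult_ac)
  qed
  have fint: "integrable (lborel \<Otimes>\<^sub>M lborel) f"
  proof (rule lborel_pair.Fubini_integrable[OF fm])
    \<comment> \<open>On \<open>Re s = 1\<close> the modulus of \<open>exp (- s * u)\<close> is
      \<open>exp (- u)\<close> for every \<theta>, so the double integral of the norms is a product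
      of two convergent integrals.\<close>
    have "norm (f (\<theta>, u)) = norm (kern 0 x t \<theta>) * (w u * exp (- u))" for \<theta> u
      by (simp add: f_def shift norm_mult w0)
    then have "(\<lambda>\<theta>. \<integral>u. norm (f (\<theta>, u)) \<partial>lborel) = (\<lambda>\<theta>. norm (kern 0 x t \<theta>) * Gamma (1 - \<alpha>))"
      using wint by (simp add: has_bochner_integral_iff)
    then show "integrable lborel (\<lambda>\<theta>. \<integral>u. norm (f (\<theta>, u)) \<partial>lborel)"
      using integrable_kern[OF t] by simp
    show "AE \<theta> in lborel. integrable lborel (\<lambda>u. f (\<theta>, u))" using f\<theta> by simp
  qed
  have inner: "(\<integral>\<theta>. f (\<theta>, u) \<partial>lborel) = of_real (w u) * (\<integral>\<theta>. kern 0 (x - u) t \<theta> \<partial>lborel)" for u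
    by (simp add: f_def)
  have ReJ: "Re (\<integral>\<theta>. kern a x t \<theta> \<partial>lborel) = 2 * pi * bromwich a x t" for a x
    using integral_Re[OF integrable_kern[OF t]] by (simp add: bromwich_def)
  have "integrable lborel (\<lambda>u. \<integral>\<theta>. f (\<theta>, u) \<partial>lborel)"
    using lborel_pair.integrable_snd[of "\<lambda>\<theta> u. f (\<theta>, u)"] fint by simp
  moreover have "(\<integral>u. (\<integral>\<theta>. f (\<theta>, u) \<partial>lborel) \<partial>lborel) =
      of_real (Gamma (1 - \<alpha>)) * (\<integral>\<theta>. kern (\<alpha> - 1) x t \<theta> \<partial>lborel)"
    using lborel_pair.Fubini_integral[of "\<lambda>\<theta> u. f (\<theta>, u)"] fint f\<theta>(2) by simp
  ultimately have "has_bochner_integral lborel (\<lambda>u. \<integral>\<theta>. f (\<theta>, u) \<partial>lborel)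
      (of_real (Gamma (1 - \<alpha>)) * (\<integral>\<theta>. kern (\<alpha> - 1) x t \<theta> \<partial>lborel))"
    by (simp add: has_bochner_integral_iff)
  from has_bochner_integral_bounded_linear[OF bounded_linear_Re this]
  have "has_bochner_integral lborel (\<lambda>u. w u * (2 * pi * bromwich 0 (x - u) t))
      (Gamma (1 - \<alpha>) * (2 * pi * bromwich (\<alpha> - 1) x t))"
    by (simp add: inner ReJ)
  from has_bochner_integral_divide[OF this, of "2 * pi"]
  show ?thesis by (simp add: w_def mult.assoc)
qed

text \<open>Substituting \<open>s = x - u\<close> turns the convolution over \<open>u > 0\<close>
  into an integral over \<open>s < x\<close>. Since the Bromwich integral vanishes for
  \<open>s \<le> 0\<close>, only the range of the Riemann-Liouville integral remains, and there
  \<open>h\<close> may replace it.\<close>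

lemma rl_kernel_bromwich:
  assumes \<alpha>: "0 < \<alpha>" "\<alpha> < 1" and t: "0 < t"
    and h: "\<And>s. 0 \<le> s \<Longrightarrow> h s = bromwich 0 s t" and J0: "\<And>s. s \<le> 0 \<Longrightarrow> bromwich 0 s t = 0"
  shows "set_integrable lborel {0<..<x} (\<lambda>s. h s / (x - s) powr (\<alpha> + 1 - real (nat \<lceil>\<alpha>\<rceil>)))"
    and "rl_kernel_integral \<alpha> h x = Gamma (1 - \<alpha>) * bromwich (\<alpha> - 1) x t"
proof -
  have ceil: "nat \<lceil>\<alpha>\<rceil> = 1" using \<alpha> by linarith
  let ?F = "\<lambda>u. indicator {0<..} u * u powr (- \<alpha>) * bromwich 0 (x - u) t"
  have "has_bochner_integral lborel (\<lambda>s. ?F (x - s)) (Gamma (1 - \<alpha>) * bromwich (\<alpha> - 1) x t)"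
    using lborel_has_bochner_integral_real_affine_iff[THEN iffD1, OF _ integral_kern_convolution[OF \<alpha> t, of x], of "-1" x]
    by simp
  moreover have "(\<lambda>s. ?F (x - s)) = (\<lambda>s. indicator {0<..<x} s *\<^sub>R (h s / (x - s) powr (\<alpha> + 1 - real (nat \<lceil>\<alpha>\<rceil>))))"
  proof
    fix s show "?F (x - s) = indicator {0<..<x} s *\<^sub>R (h s / (x - s) powr (\<alpha> + 1 - real (nat \<lceil>\<alpha>\<rceil>)))"
      using J0[of s] h[of s] by (cases "s \<le> 0") (auto simp: ceil indicator_def powr_minus field_simps)
  qed
  ultimately have *: "has_bochner_integral lborel
      (\<lambda>s. indicator {0<..<x} s *\<^sub>R (h s / (x - s) powr (\<alpha> + 1 - real (nat \<lceil>\<alpha>\<rceil>))))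
      (Gamma (1 - \<alpha>) * bromwich (\<alpha> - 1) x t)" by simp
  then show "set_integrable lborel {0<..<x} (\<lambda>s. h s / (x - s) powr (\<alpha> + 1 - real (nat \<lceil>\<alpha>\<rceil>)))"
    "rl_kernel_integral \<alpha> h x = Gamma (1 - \<alpha>) * bromwich (\<alpha> - 1) x t"
    by (simp_all add: set_integrable_def rl_kernel_integral_def set_lebesgue_integral_def
        has_bochner_integral_iff)
qed

text \<open>An order in (0, 1) calls for one ordinary derivative, which raises the index from
  \<open>\<alpha> - 1\<close> to \<open>\<alpha>\<close>; the Gamma factor of the fractional
  integral cancels the one in the definition.\<close>

lemma rl_deriv_bromwich:
  assumes \<alpha>: "0 < \<alpha>" "\<alpha> < 1" and t: "0 < t"
    and h: "\<And>s. 0 \<le> s \<Longrightarrow> h s = bromwich 0 s t" and J0: "\<And>s. s \<le> 0 \<Longrightarrow> bromwich 0 s t = 0"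
  shows "rl_differentiable \<alpha> h" and "rl_deriv \<alpha> h x = bromwich \<alpha> x t"
proof -
  have ceil: "nat \<lceil>\<alpha>\<rceil> = 1" using \<alpha> by linarith
  have K: "rl_kernel_integral \<alpha> h = (\<lambda>x. Gamma (1 - \<alpha>) * bromwich (\<alpha> - 1) x t)"
    using rl_kernel_bromwich(2)[OF assms] by blast
  have D: "(rl_kernel_integral \<alpha> h has_real_derivative Gamma (1 - \<alpha>) * bromwich \<alpha> x t) (at x)" for x
    unfolding K using DERIV_cmult[OF bromwich_deriv_x[OF t, of "\<alpha> - 1" x]] by simp
  show "rl_differentiable \<alpha> h"
    unfolding rl_differentiable_def
    using rl_kernel_bromwich(1)[OF assms] D by (auto simp: ceil real_differentiable_def)
  have "0 < Gamma (1 - \<alpha>)" using \<alpha> by (intro Gamma_real_pos) simp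
  then show "rl_deriv \<alpha> h x = bromwich \<alpha> x t"
    unfolding rl_deriv_def using DERIV_imp_deriv[OF D] by (simp add: ceil)
qed

text \<open>The inversion formula is applied to the tilted law \<open>e\<^sup>-\<^sup>x P(dx)\<close>, whose characteristic function
  is the Laplace transform of \<open>P\<close> on the line \<open>Re s = 1\<close>; this avoids boundary values on the
  imaginary axis.\<close>

lemma density_of_laplace_transform:
  assumes P: "real_distribution P" and t: "0 < t" and nonneg: "AE x in P. 0 \<le> x"
    and L: "\<And>\<mu>. 0 < \<mu> \<Longrightarrow>
      (\<integral>x. exp (- \<mu> * x) \<partial>P) = exp (- t * (\<mu> powr (2 * \<nu>) + 2 * lam * \<mu> powr \<nu>))"
  shows "P = density lborel (\<lambda>x. ennreal (bromwich 0 x t))" and "0 \<le> bromwich 0 x t"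
    and "x \<le> 0 \<Longrightarrow> bromwich 0 x t = 0"
proof -
  interpret P: real_distribution P by (rule P)
  \<comment> \<open>The normalising constant of the tilted law: the Laplace transform of
    \<open>P\<close> at 1, where \<open>\<psi>\<close> has the value
    \<open>1 + 2 * lam\<close>.\<close>
  define Z where "Z = exp (- t * (1 + 2 * lam))"
  have Z: "0 < Z" by (simp add: Z_def)
  have intL: "integrable P (\<lambda>x. exp (- \<mu> * x))" if "0 < \<mu>" for \<mu>
    by (rule P.integrable_const_bound[where B = 1]) (use nonneg that in \<open>auto elim: eventually_mono\<close>)
  have LC: "(\<integral>x. exp (- s * of_real x) \<partial>P) = exp (- of_real t * \<psi> s)" if "0 < Re s" for s
  proof (rule laplace_analytic_continuation[OF _ nonneg intL])
    show "complex_of_real (\<integral>x. exp (- \<mu> * x) \<partial>P) = exp (- of_real t * \<psi> (of_real \<mu>))" if "0 < \<mu>" for \<mu>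
      using that by (simp only: L psi_of_real less_imp_le flip: of_real_mult of_real_minus exp_of_real)
    show "(\<lambda>s. exp (- of_real t * \<psi> s)) holomorphic_on {s. 0 < Re s}"
      by (intro holomorphic_intros holomorphic_psi)
  qed (use that in auto)
  define N where "N = density P (\<lambda>x. ennreal (exp (- x) / Z))"
  have intZ: "integrable P (\<lambda>x. exp (- x) / Z)" using intL[of 1] by simp
  have LZ: "(\<integral>x. exp (- x) / Z \<partial>P) = 1" using L[of 1] Z by (simp add: Z_def)
  have "prob_space N"
  proof (rule prob_spaceI)
    have "emeasure N (space N) = (\<integral>\<^sup>+x. ennreal (exp (- x) / Z) \<partial>P)"
      by (simp add: N_def emeasure_density)
    also have "\<dots> = ennreal (\<integral>x. exp (- x) / Z \<partial>P)"
      using intZ Z by (intro nn_integral_eq_integral) auto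
    finally show "emeasure N (space N) = 1" unfolding LZ by simp
  qed
  then interpret N: real_distribution N
    by (simp add: real_distribution_def real_distribution_axioms_def N_def)
  \<comment> \<open>The factors \<open>exp (- x)\<close> and \<open>iexp (\<theta> * x)\<close>
    combine to \<open>exp (- s * x)\<close> with \<open>s = 1 - \<i>\<theta>\<close>, whence the
    sign of the argument on the right.\<close>
  have char: "char N \<theta> = kern 0 0 t (- \<theta>) / of_real Z" for \<theta>
  proof -
    have "char N \<theta> = (\<integral>x. (exp (- x) / Z) *\<^sub>R iexp (\<theta> * x) \<partial>P)"
      unfolding char_def N_def using Z by (subst integral_density) auto
    also have "\<dots> = (\<integral>x. exp (- Complex 1 (- \<theta>) * of_real x) / of_real Z \<partial>P)"
    proof (rule Bochner_Integration.integral_cong[OF refl])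
      fix x :: real
      have "- Complex 1 (- \<theta>) * of_real x = of_real (- x) + \<i> * of_real (\<theta> * x)"
        by (simp add: complex_eq_iff)
      then have "exp (- Complex 1 (- \<theta>) * of_real x) = of_real (exp (- x)) * iexp (\<theta> * x)"
        by (simp only: exp_add exp_of_real)
      then show "(exp (- x) / Z) *\<^sub>R iexp (\<theta> * x) = exp (- Complex 1 (- \<theta>) * of_real x) / of_real Z"
        by (simp add: scaleR_conv_of_real)
    qed
    also have "\<dots> = exp (- of_real t * \<psi> (Complex 1 (- \<theta>))) / of_real Z"
      using LC[of "Complex 1 (- \<theta>)"] by simp
    finally show ?thesis by (simp add: kern_def)
  qed
  have intk: "integrable lborel (\<lambda>\<theta>. kern 0 0 t (- \<theta>))"
    using lborel_integrable_real_affine[OF integrable_kern[OF t], of "-1" 0 0 0] by simp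
  have int: "integrable lborel (char N)"
  proof -
    have "char N = (\<lambda>\<theta>. kern 0 0 t (- \<theta>) / of_real Z)" using char by blast
    then show ?thesis using intk by simp
  qed
  define g where "g x = Re ((\<integral>\<theta>. iexp (- (\<theta> * x)) * char N \<theta> \<partial>lborel) / (2 * pi))" for x
  \<comment> \<open>Reflecting \<theta> restores the orientation of the Bromwich line, and
    \<open>Z * exp x\<close> undoes the normalisation and the tilt.\<close>
  have gJ: "bromwich 0 x t = Z * exp x * g x" for x
  proof -
    have "(\<integral>\<theta>. iexp (- (\<theta> * x)) * char N \<theta> \<partial>lborel) =
        (\<integral>\<theta>. iexp (\<theta> * x) * (kern 0 0 t \<theta> / of_real Z) \<partial>lborel)"
      using lborel_integral_real_affine[of "-1" "\<lambda>\<theta>. iexp (- (\<theta> * x)) * char N \<theta>" 0]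
      by (simp add: char)
    also have "\<dots> = (\<integral>\<theta>. kern 0 x t \<theta> / of_real (Z * exp x) \<partial>lborel)"
    proof (rule Bochner_Integration.integral_cong[OF refl])
      fix \<theta> :: real
      have "of_real x * Complex 1 \<theta> = of_real x + \<i> * of_real (\<theta> * x)"
        by (simp add: complex_eq_iff)
      then have "exp (of_real x * Complex 1 \<theta>) = of_real (exp x) * iexp (\<theta> * x)"
        by (simp only: exp_add exp_of_real)
      then have "kern 0 x t \<theta> = of_real (exp x) * (iexp (\<theta> * x) * kern 0 0 t \<theta>)"
        by (simp add: kern_def)
      then show "iexp (\<theta> * x) * (kern 0 0 t \<theta> / of_real Z) = kern 0 x t \<theta> / of_real (Z * exp x)"
        using Z by (simp add: exp_of_real)
    qed
    also have "\<dots> = (\<integral>\<theta>. kern 0 x t \<theta> \<partial>lborel) / of_real (Z * exp x)" by simp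
    finally have "g x = Re ((\<integral>\<theta>. kern 0 x t \<theta> \<partial>lborel) / of_real (Z * exp x * (2 * pi)))"
      by (simp add: g_def)
    also have "\<dots> = Re (\<integral>\<theta>. kern 0 x t \<theta> \<partial>lborel) / (Z * exp x * (2 * pi))"
      by (rule Re_divide_of_real)
    finally show ?thesis
      using integral_Re[OF integrable_kern[OF t, of 0 x]] Z by (simp add: bromwich_def)
  qed
  have g0: "0 \<le> g x" for x unfolding g_def by (rule N.inversion_density_nonneg[OF int])
  then show J0: "0 \<le> bromwich 0 x t" for x using Z by (simp add: gJ)
  have Jm [measurable]: "(\<lambda>x. bromwich 0 x t) \<in> borel_measurable borel"
    by (intro borel_measurable_continuous_onI continuous_on_bromwich t)
  have gm [measurable]: "g \<in> borel_measurable borel"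
  proof -
    have "g = (\<lambda>x. bromwich 0 x t / (Z * exp x))" using Z by (auto simp: gJ)
    then show ?thesis by simp
  qed
  have Ng: "N = density lborel (\<lambda>x. ennreal (g x))"
    unfolding g_def by (rule N.density_inversion_formula[OF int])
  \<comment> \<open>Since \<open>exp (- x) / Z\<close> and \<open>Z * exp x\<close> are reciprocal,
    the density of \<open>P\<close> is recovered from that of \<open>N\<close>.\<close>
  have "P = density P (\<lambda>x. 1)" by (simp add: density_1)
  also have "\<dots> = density P (\<lambda>x. ennreal (exp (- x) / Z) * ennreal (Z * exp x))"
    using Z by (intro density_cong) (auto simp: ennreal_mult[symmetric] exp_minus)
  also have "\<dots> = density N (\<lambda>x. ennreal (Z * exp x))"
    unfolding N_def by (rule density_density_eq[symmetric]) auto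
  also have "\<dots> = density lborel (\<lambda>x. ennreal (g x) * ennreal (Z * exp x))"
    unfolding Ng by (rule density_density_eq) auto
  also have "\<dots> = density lborel (\<lambda>x. ennreal (bromwich 0 x t))"
    using g0 Z by (intro density_cong) (auto simp: ennreal_mult[symmetric] gJ mult_ac)
  finally show PJ: "P = density lborel (\<lambda>x. ennreal (bromwich 0 x t))" .
  \<comment> \<open>\<open>P\<close> has no mass on the negative half-line, so its density vanishes
    almost everywhere there. Continuity makes it vanish everywhere on the closed half-line; its
    value at 0 becomes the boundary condition.\<close>
  have "AE x in lborel. 0 < bromwich 0 x t \<longrightarrow> 0 \<le> x"
    using nonneg unfolding PJ by (simp add: AE_density)
  then have "AE x in lborel. x \<in> {..<0} \<longrightarrow> bromwich 0 x t = 0"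
    by eventually_elim (use J0 in \<open>auto simp: order.order_iff_strict\<close>)
  then show "x \<le> 0 \<Longrightarrow> bromwich 0 x t = 0"
    by (intro AE_eq_continuous_imp_eq_closure[where S = "{..<0}" and g = "\<lambda>_. 0"] continuous_on_bromwich t) auto
qed

end

section \<open>Laws of subordinators\<close>

lemma subordinator_AE_nonneg:
  assumes "subordinator M H" and t: "0 \<le> t"
  shows "AE \<omega> in M. 0 \<le> H t \<omega>"
proof -
  have "AE \<omega> in M. H 0 \<omega> = 0" "AE \<omega> in M. mono_on {0..} (\<lambda>t. H t \<omega>)"
    using assms(1) by (auto simp: subordinator_def)
  then show ?thesis
  proof eventually_elim
    case (elim \<omega>)
    then show ?case using mono_onD[OF elim(2), of 0 t] t by simp
  qed
qed

lemma subordinator_AE_tendsto_0: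
  assumes "subordinator M H"
  shows "AE \<omega> in M. ((\<lambda>t. H t \<omega>) \<longlongrightarrow> 0) (at_right 0)"
proof -
  have "AE \<omega> in M. H 0 \<omega> = 0" "AE \<omega> in M. \<forall>t\<ge>0. continuous (at_right t) (\<lambda>t. H t \<omega>)"
    using assms(1) by (auto simp: subordinator_def)
  then show ?thesis
  proof eventually_elim
    case (elim \<omega>)
    then have "continuous (at_right 0) (\<lambda>t. H t \<omega>)" by blast
    then show ?case using elim by (simp add: continuous_within)
  qed
qed

text \<open>Evaluation at time \<open>t\<close> is a measurable functional of the path, so
  independence of the paths passes to the two exponentials, which are bounded almost surely, and
  their expectation factorises.\<close>

lemma (in prob_space) laplace_transform_add_independent:
  fixes c :: real
  assumes ind: "independent_processes M H1 H2" and t: "0 \<le> t"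
    and H1: "H1 t \<in> borel_measurable M" "AE \<omega> in M. 0 \<le> H1 t \<omega>"
    and H2: "H2 t \<in> borel_measurable M" "AE \<omega> in M. 0 \<le> H2 t \<omega>"
    and c: "0 \<le> c" and \<mu>: "0 \<le> \<mu>"
  shows "(LINT \<omega>|M. exp (- \<mu> * (H1 t \<omega> + c * H2 t \<omega>))) =
    (LINT \<omega>|M. exp (- \<mu> * H1 t \<omega>)) * (LINT \<omega>|M. exp (- (c * \<mu>) * H2 t \<omega>))"
proof -
  let ?F = "\<lambda>\<mu> f. exp (- \<mu> * f t) :: real"
  have meas: "?F \<mu> \<in> borel_measurable (\<Pi>\<^sub>M t\<in>{0..}. borel)" for \<mu>
    by (rule measurable_compose[OF measurable_component_singleton]) (use t in auto)
  have "indep_var borel (?F \<mu> \<circ> (\<lambda>\<omega>. \<lambda>t\<in>{0..}. H1 t \<omega>)) borel (?F (c * \<mu>) \<circ> (\<lambda>\<omega>. \<lambda>t\<in>{0..}. H2 t \<omega>))"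
    using ind unfolding independent_processes_def by (rule indep_var_compose) (rule meas)+
  then have iv: "indep_var borel (\<lambda>\<omega>. exp (- \<mu> * H1 t \<omega>)) borel (\<lambda>\<omega>. exp (- (c * \<mu>) * H2 t \<omega>))"
    using t by (simp add: comp_def)
  have "(LINT \<omega>|M. exp (- \<mu> * (H1 t \<omega> + c * H2 t \<omega>))) =
      (LINT \<omega>|M. exp (- \<mu> * H1 t \<omega>) * exp (- (c * \<mu>) * H2 t \<omega>))"
    by (intro Bochner_Integration.integral_cong refl) (simp add: algebra_simps flip: exp_add)
  also have "\<dots> = (LINT \<omega>|M. exp (- \<mu> * H1 t \<omega>)) * (LINT \<omega>|M. exp (- (c * \<mu>) * H2 t \<omega>))"
  proof (rule indep_var_lebesgue_integral[OF iv])
    show "integrable M (\<lambda>\<omega>. exp (- \<mu> * H1 t \<omega>))"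
      by (rule integrable_const_bound[where B = 1])
         (use H1 \<mu> in \<open>auto elim: eventually_mono\<close>)
    show "integrable M (\<lambda>\<omega>. exp (- (c * \<mu>) * H2 t \<omega>))"
      by (rule integrable_const_bound[where B = 1])
         (use H2 \<mu> c in \<open>auto elim: eventually_mono\<close>)
  qed
  finally show ?thesis .
qed

text \<open>Integrals against the law are expectations of \<open>f (X t)\<close>, and these converge
  by dominated convergence because \<open>f\<close> is bounded and continuous and the paths tend to
  0.\<close>

lemma (in prob_space) initial_dirac_of_law:
  assumes law: "is_law M X h" and meas: "\<And>t. 0 < t \<Longrightarrow> X t \<in> borel_measurable M"
    and lim: "AE \<omega> in M. ((\<lambda>t. X t \<omega>) \<longlongrightarrow> 0) (at_right 0)"
  shows "initial_dirac h"
  unfolding initial_dirac_def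
proof (intro allI impI)
  fix f :: "real \<Rightarrow> real"
  assume f: "continuous_on UNIV f" and "bounded (range f)"
  then obtain B where B: "\<And>x. \<bar>f x\<bar> \<le> B" by (auto simp: bounded_iff)
  have [measurable]: "f \<in> borel_measurable borel" using f by (rule borel_measurable_continuous_onI)
  have eq: "(LINT x:{0..}|lborel. f x * h x t) = (LINT \<omega>|M. f (X t \<omega>))" if t: "0 < t" for t
  proof -
    have "(\<integral>x. (indicator {0..} x * h x t) * f x \<partial>lborel) = (LINT \<omega>|M. f (X t \<omega>))"
      using law t by (intro distributed_integral) (auto simp: is_law_def indicator_def)
    then show ?thesis by (simp add: set_lebesgue_integral_def mult_ac)
  qed
  have "((\<lambda>t. LINT \<omega>|M. f (X t \<omega>)) \<longlongrightarrow> f 0) (at_right 0)"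
    unfolding tendsto_at_iff_sequentially comp_def
  proof (intro allI impI)
    fix Y :: "nat \<Rightarrow> real"
    assume Y: "\<forall>i. Y i \<in> {0<..} - {0}" and Y0: "Y \<longlonglongrightarrow> 0"
    have "(\<lambda>i. LINT \<omega>|M. f (X (Y i) \<omega>)) \<longlonglongrightarrow> (LINT \<omega>|M. f 0)"
    proof (rule integral_dominated_convergence[where w = "\<lambda>_. B"])
      show "AE \<omega> in M. (\<lambda>i. f (X (Y i) \<omega>)) \<longlonglongrightarrow> f 0"
        using lim
      proof eventually_elim
        case (elim \<omega>)
        from this[unfolded tendsto_at_iff_sequentially comp_def, rule_format, of Y] Y Y0
        have "(\<lambda>i. X (Y i) \<omega>) \<longlonglongrightarrow> 0" by simp
        moreover have "isCont f 0" using f by (simp add: continuous_on_eq_continuous_at)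
        ultimately show ?case using isCont_tendsto_compose by blast
      qed
      show "(\<lambda>\<omega>. f (X (Y i) \<omega>)) \<in> borel_measurable M" for i
        using meas[of "Y i"] Y by simp
    qed (use B in auto)
    then show "(\<lambda>i. LINT \<omega>|M. f (X (Y i) \<omega>)) \<longlonglongrightarrow> f 0" by (simp add: prob_space)
  qed
  moreover have "\<forall>\<^sub>F t in at_right 0. (LINT \<omega>|M. f (X t \<omega>)) = (LINT x:{0..}|lborel. f x * h x t)"
    using eq by (auto simp: eventually_at_filter)
  ultimately show "((\<lambda>t. LINT x:{0..}|lborel. f x * h x t) \<longlongrightarrow> f 0) (at_right 0)"
    by (rule Lim_transform_eventually)
qed

text \<open>Two densities of one distribution agree almost everywhere; nonnegativity carries this
  from \<open>ennreal\<close> to the reals, and continuity carries it to every point, including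
  0.\<close>

lemma is_law_unique:
  assumes h: "is_law M X h" and g: "is_law M X g" and t: "0 < t" and x: "0 \<le> x"
  shows "h x t = g x t"
proof -
  have dh: "distributed M lborel (X t) (\<lambda>x. ennreal (indicator {0..} x * h x t))"
    and dg: "distributed M lborel (X t) (\<lambda>x. ennreal (indicator {0..} x * g x t))"
    and nonneg: "\<And>x. 0 \<le> x \<Longrightarrow> 0 \<le> h x t" "\<And>x. 0 \<le> x \<Longrightarrow> 0 \<le> g x t"
    and cont: "continuous_on {0..} (\<lambda>x. h x t)" "continuous_on {0..} (\<lambda>x. g x t)"
    using h g t by (auto simp: is_law_def)
  have "AE x in lborel. ennreal (indicator {0..} x * h x t) = ennreal (indicator {0..} x * g x t)"
    using dh dg by (intro sigma_finite_measure.density_unique[OF sigma_finite_lborel]) (simp_all add: distributed_def)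
  then have "AE x in lborel. x \<in> {0<..} \<longrightarrow> h x t = g x t"
  proof eventually_elim
    case (elim x)
    then show ?case using nonneg[of x] by auto
  qed
  moreover have "closure {0<..} = {0::real..}" by simp
  ultimately show ?thesis
    using AE_eq_continuous_imp_eq_closure[of "{0<..}" "\<lambda>x. h x t" "\<lambda>x. g x t" x] x cont by simp
qed

text \<open>The problem is solved by every continuous version of the law, and the existence clause
  keeps this from being vacuous.\<close>

theorem theorem2p1:
  fixes M :: "'a measure" and \<nu> lam :: real and H1 H2 \<H> :: "real \<Rightarrow> 'a \<Rightarrow> real"
  assumes "prob_space M"
    and "0 < \<nu>" and "\<nu> < 1 / 2" and "0 < lam"
    and "stable_subordinator M (2 * \<nu>) H1"
    and "stable_subordinator M \<nu> H2"
    and "independent_processes M H1 H2"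
    and "\<And>t \<omega>. \<H> t \<omega> = H1 t \<omega> + (2 * lam) powr (1 / \<nu>) * H2 t \<omega>"
  shows "(\<exists>h. is_law M \<H> h) \<and>
    (\<forall>h. is_law M \<H> h \<longrightarrow>
      (\<forall>t>0. rl_differentiable (2 * \<nu>) (\<lambda>x. h x t) \<and> rl_differentiable \<nu> (\<lambda>x. h x t)) \<and>
      (\<forall>x>0. \<forall>t>0.
         ((\<lambda>t. h x t) has_real_derivative
            - (rl_deriv (2 * \<nu>) (\<lambda>x. h x t) x + 2 * lam * rl_deriv \<nu> (\<lambda>x. h x t) x)) (at t)) \<and>
      (\<forall>t>0. h 0 t = 0) \<and>
      initial_dirac h)"
proof -
  interpret prob_space M by fact
  interpret fractional_exponent \<nu> lam by unfold_locales fact+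
  define c where "c = (2 * lam) powr (1 / \<nu>)"
  have c: "0 < c" using assms(4) by (simp add: c_def)
  \<comment> \<open>The scaling constant is chosen for this identity: the scaled second subordinator
    contributes \<open>2 * lam * \<mu> powr \<nu>\<close> to the Laplace exponent.\<close>
  have c\<nu>: "c powr \<nu> = 2 * lam" using assms(2,4) by (simp add: c_def powr_powr)
  have \<H>: "\<H> t = (\<lambda>\<omega>. H1 t \<omega> + c * H2 t \<omega>)" for t using assms(8) by (auto simp: c_def)
  have sub: "subordinator M H1" "subordinator M H2"
    using assms(5,6) by (auto simp: stable_subordinator_def)
  have m12: "H1 t \<in> borel_measurable M" "H2 t \<in> borel_measurable M" if "0 \<le> t" for t
    using sub that by (auto simp: subordinator_def)
  have meas: "\<H> t \<in> borel_measurable M" if "0 < t" for t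
    using m12[of t] that by (simp add: \<H>)
  have nonneg: "AE \<omega> in M. 0 \<le> \<H> t \<omega>" if "0 < t" for t
    using subordinator_AE_nonneg[OF sub(1), of t] subordinator_AE_nonneg[OF sub(2), of t] that c
    by (auto simp: \<H>)
  have lap: "(LINT \<omega>|M. exp (- \<mu> * \<H> t \<omega>)) = exp (- t * (\<mu> powr (2 * \<nu>) + 2 * lam * \<mu> powr \<nu>))"
    if t: "0 < t" and \<mu>: "0 < \<mu>" for t \<mu>
  proof -
    have "(LINT \<omega>|M. exp (- \<mu> * \<H> t \<omega>)) =
        (LINT \<omega>|M. exp (- \<mu> * H1 t \<omega>)) * (LINT \<omega>|M. exp (- (c * \<mu>) * H2 t \<omega>))"
      unfolding \<H> using t \<mu> c
      by (intro laplace_transform_add_independent assms(7) m12 subordinator_AE_nonneg sub) auto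
    also have "\<dots> = exp (- t * \<mu> powr (2 * \<nu>)) * exp (- t * (c * \<mu>) powr \<nu>)"
      using assms(5,6) t \<mu> c by (simp add: stable_subordinator_def)
    also have "\<dots> = exp (- t * (\<mu> powr (2 * \<nu>) + 2 * lam * \<mu> powr \<nu>))"
      using c \<mu> by (simp add: powr_mult c\<nu> algebra_simps flip: exp_add)
    finally show ?thesis .
  qed
  have P: "distr M borel (\<H> t) = density lborel (\<lambda>x. ennreal (bromwich 0 x t))" "0 \<le> bromwich 0 x t"
    "x \<le> 0 \<Longrightarrow> bromwich 0 x t = 0" if t: "0 < t" for t x
  proof -
    note m [measurable] = meas[OF t]
    have rd: "real_distribution (distr M borel (\<H> t))"
      by (simp add: real_distribution_def real_distribution_axioms_def prob_space_distr)
    have nn: "AE x in distr M borel (\<H> t). 0 \<le> x" using nonneg[OF t] by (simp add: AE_distr_iff)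
    have L: "(\<integral>x. exp (- \<mu> * x) \<partial>distr M borel (\<H> t)) =
        exp (- t * (\<mu> powr (2 * \<nu>) + 2 * lam * \<mu> powr \<nu>))" if "0 < \<mu>" for \<mu>
      using lap[OF t that] by (simp add: integral_distr)
    note D = density_of_laplace_transform[OF rd t nn L]
    show "distr M borel (\<H> t) = density lborel (\<lambda>x. ennreal (bromwich 0 x t))" by (rule D(1))
    show "0 \<le> bromwich 0 x t" by (rule D(2))
    show "x \<le> 0 \<Longrightarrow> bromwich 0 x t = 0" by (rule D(3))
  qed
  have law: "is_law M \<H> (bromwich 0)"
    unfolding is_law_def
  proof (intro allI impI conjI)
    fix t :: real assume t: "0 < t"
    show "continuous_on {0..} (\<lambda>x. bromwich 0 x t)" by (rule continuous_on_bromwich[OF t])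
    \<comment> \<open>The indicator changes nothing because the Bromwich integral already vanishes
      on the negative half-line.\<close>
    have eq: "(\<lambda>x. ennreal (indicator {0..} x * bromwich 0 x t)) = (\<lambda>x. ennreal (bromwich 0 x t))"
      using P(3)[OF t] by (auto simp: indicator_def)
    have "(\<lambda>x. bromwich 0 x t) \<in> borel_measurable borel"
      by (intro borel_measurable_continuous_onI continuous_on_bromwich t)
    moreover have "distr M lborel (\<H> t) = distr M borel (\<H> t)" by (rule distr_cong) auto
    ultimately show "distributed M lborel (\<H> t) (\<lambda>x. ennreal (indicator {0..} x * bromwich 0 x t))"
      using P(1)[OF t] meas[OF t] unfolding eq by (simp add: distributed_def)
  qed (rule P(2))
  show ?thesis
  proof (intro conjI allI impI)
    show "\<exists>h. is_law M \<H> h" using law by blast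
  next
    fix h assume h: "is_law M \<H> h"
    \<comment> \<open>By uniqueness an arbitrary law coincides with the Bromwich integral on the
      closed half-line, so each claim can be transferred from there.\<close>
    have hJ: "h x t = bromwich 0 x t" if "0 < t" "0 \<le> x" for x t
      using is_law_unique[OF h law] that by blast
    have rl: "rl_differentiable \<alpha> (\<lambda>x. h x t)" "rl_deriv \<alpha> (\<lambda>x. h x t) x = bromwich \<alpha> x t"
      if "0 < \<alpha>" "\<alpha> < 1" "0 < t" for \<alpha> t x
      using rl_deriv_bromwich[OF that hJ[OF \<open>0 < t\<close>] P(3)[OF \<open>0 < t\<close>]] by auto
    show "rl_differentiable (2 * \<nu>) (\<lambda>x. h x t)" "rl_differentiable \<nu> (\<lambda>x. h x t)" if "0 < t" for t
      using rl(1)[OF _ _ that] assms(2,3) by auto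
    show "h 0 t = 0" if "0 < t" for t using hJ[OF that] P(3)[OF that] by simp
    show "initial_dirac h"
    proof (rule initial_dirac_of_law[OF h meas])
      show "AE \<omega> in M. ((\<lambda>t. \<H> t \<omega>) \<longlongrightarrow> 0) (at_right 0)"
        using subordinator_AE_tendsto_0[OF sub(1)] subordinator_AE_tendsto_0[OF sub(2)]
      proof eventually_elim
        case (elim \<omega>)
        from tendsto_add[OF elim(1) tendsto_mult_left[OF elim(2), of c]] show ?case by (simp add: \<H>)
      qed
    qed
    fix x t :: real assume x: "0 < x" and t: "0 < t"
    have "((\<lambda>t. bromwich 0 x t) has_real_derivative - (bromwich (2 * \<nu>) x t + 2 * lam * bromwich \<nu> x t)) (at t)"
      using bromwich_deriv_t[OF t, of 0 x] by simp
    \<comment> \<open>For fixed \<open>x\<close> the two functions agree on the open set of all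
      positive times, so they share the time derivative.\<close>
    then have "((\<lambda>t. h x t) has_real_derivative - (bromwich (2 * \<nu>) x t + 2 * lam * bromwich \<nu> x t)) (at t)"
      by (rule has_field_derivative_transform_within_open[where S = "{0<..}"]) (use t x hJ in auto)
    then show "((\<lambda>t. h x t) has_real_derivative
        - (rl_deriv (2 * \<nu>) (\<lambda>x. h x t) x + 2 * lam * rl_deriv \<nu> (\<lambda>x. h x t) x)) (at t)"
      using rl(2)[OF _ _ t] assms(2,3) by simp
  qed
qed

end
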